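(* Let $p$ be any odd prime and let $H$ be any finite group. For all sufficiently large integers $n$, there exists a finite $p$-group $G$ of nilpotency class two and of order $p^{n+\binom{n}{2}}$ such that $H$ embeds into $T(G)$ (i.e. $T(G)$ has a subgroup isomorphic to $H$).
   Context: For a group $G$, let $S(G)$ be the group of permutations of the set $G$, with maps composed from left to right, and let $\rho:G\to S(G)$ be the right regular representation, $x^{\rho(y)}=xy$. The holomorph of $G$ is $\mathrm{Hol}(G)=N_{S(G)}(\rho(G))$, the multiple holomorph of $G$ is $\mathrm{NHol}(G)=N_{S(G)}(\mathrm{Hol}(G))$, and $T(G)=\mathrm{NHol}(G)/\mathrm{Hol}(G)$. *)

theory Defs
  imports "HOL-Algebra.Algebra"
begin

section \<open>The multiple holomorph\<close>

text \<open>The library group \<^const>\<open>BijGroup\<close> composes maps from right to left.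
  Here permutations act on the right and are composed from left to right, so the
  multiplication is reversed.\<close>

definition perm_group :: "'a set \<Rightarrow> ('a \<Rightarrow> 'a) monoid" where
  "perm_group S = (BijGroup S)\<lparr>mult := \<lambda>f g. g \<otimes>\<^bsub>BijGroup S\<^esub> f\<rparr>"

definition right_regular :: "('a, 'b) monoid_scheme \<Rightarrow> 'a \<Rightarrow> 'a \<Rightarrow> 'a" where
  "right_regular G y = (\<lambda>x \<in> carrier G. x \<otimes>\<^bsub>G\<^esub> y)"

definition Hol :: "('a, 'b) monoid_scheme \<Rightarrow> ('a \<Rightarrow> 'a) set" where
  "Hol G = normalizer (perm_group (carrier G)) (right_regular G ` carrier G)"

definition NHol :: "('a, 'b) monoid_scheme \<Rightarrow> ('a \<Rightarrow> 'a) set" where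
  "NHol G = normalizer (perm_group (carrier G)) (Hol G)"

definition T_group :: "('a, 'b) monoid_scheme \<Rightarrow> ('a \<Rightarrow> 'a) set monoid" where
  "T_group G = (perm_group (carrier G))\<lparr>carrier := NHol G\<rparr> Mod Hol G"

section \<open>Nilpotency class\<close>

text \<open>The indexing starts at \<open>0\<close>: the set \<open>lower_central G i\<close> is the term usually written
  \<open>\<gamma>\<close> with subscript \<open>i + 1\<close>, so class \<open>c\<close> means that \<open>c\<close> is the least index at which the
  series reaches the trivial subgroup.\<close>

primrec lower_central :: "('a, 'b) monoid_scheme \<Rightarrow> nat \<Rightarrow> 'a set" where
  "lower_central G 0 = carrier G"
| "lower_central G (Suc i) = generate G
     {h \<otimes>\<^bsub>G\<^esub> g \<otimes>\<^bsub>G\<^esub> inv\<^bsub>G\<^esub> h \<otimes>\<^bsub>G\<^esub> inv\<^bsub>G\<^esub> g | h g. h \<in> lower_central G i \<and> g \<in> carrier G}"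

definition has_nilpotency_class :: "('a, 'b) monoid_scheme \<Rightarrow> nat \<Rightarrow> bool" where
  "has_nilpotency_class G c \<longleftrightarrow>
     lower_central G c = {\<one>\<^bsub>G\<^esub>} \<and> (\<forall>i<c. lower_central G i \<noteq> {\<one>\<^bsub>G\<^esub>})"

section \<open>Well-definedness\<close>

lemma group_perm_group: "group (perm_group S)"
proof -
  interpret B: group "BijGroup S" by (rule group_BijGroup)
  show ?thesis
    by (rule groupI) (auto simp: perm_group_def B.m_assoc intro: B.r_inv_ex)
qed

lemma right_regular_hom:
  assumes "group G"
  shows "right_regular G \<in> hom G (perm_group (carrier G))"
proof -
  interpret group G by fact
  have bij: "right_regular G y \<in> Bij (carrier G)" if "y \<in> carrier G" for y
  proof -
    have "bij_betw (\<lambda>x. x \<otimes>\<^bsub>G\<^esub> y) (carrier G) (carrier G)"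
      by (rule bij_betw_byWitness[where f' = "\<lambda>x. x \<otimes>\<^bsub>G\<^esub> inv\<^bsub>G\<^esub> y"])
        (use that in \<open>auto simp: m_assoc\<close>)
    then show ?thesis
      by (auto simp: Bij_def right_regular_def)
  qed
  show ?thesis
    by (rule homI)
      (use bij in \<open>auto simp: perm_group_def BijGroup_def right_regular_def compose_def m_assoc\<close>)
qed

lemma subgroup_Hol:
  assumes "group G"
  shows "subgroup (Hol G) (perm_group (carrier G))"
proof -
  have "right_regular G ` carrier G \<subseteq> carrier (perm_group (carrier G))"
    using right_regular_hom[OF assms] by (auto simp: hom_def)
  then show ?thesis
    unfolding Hol_def by (rule group.normalizer_imp_subgroup[OF group_perm_group])
qed

lemma Hol_normal_NHol:
  assumes "group G"
  shows "Hol G \<lhd> (perm_group (carrier G))\<lparr>carrier := NHol G\<rparr>"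
  unfolding NHol_def
  by (rule group.subgroup_in_normalizer[OF group_perm_group subgroup_Hol[OF assms]])

lemma group_T_group:
  assumes "group G"
  shows "group (T_group G)"
  unfolding T_group_def by (rule normal.factorgroup_is_group[OF Hol_normal_NHol[OF assms]])

end

theory Submission
  imports Defs "HOL-Number_Theory.Cong"
begin

text \<open>Let \<open>W\<close> be a central subgroup of \<open>G\<close> such that every automorphism of \<open>G\<close> acts trivially on both
  \<open>W\<close> and \<open>G/W\<close>. A permutation of \<open>G\<close> that permutes coordinates of \<open>W\<close> and fixes \<open>G/W\<close> changes the
  product only by a bilinear map \<open>G/W \<times> G/W \<rightarrow> W\<close>, and translating one argument of such a map is a
  central automorphism; hence the permutation normalises the holomorph, but it is an automorphism
  only if it respects the commutator map. It remains to find a rigid \<open>G\<close> in which \<open>W\<close> has room for an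
  action of \<open>H\<close>. Take generators \<open>x\<close> indexed by \<open>0, \<dots>, n - 1\<close>, class two, independent commutators of
  order \<open>p\<close>, and the power relations \<open>x_i^p = [x_i, x_(i-1)]\<close> for \<open>i \<ge> 1\<close> and \<open>x_0^p = [x_(n-1), x_1]\<close>.
  The elements \<open>x\<close> with \<open>x^p \<in> [x, G]\<close> are, modulo \<open>W\<close>, the powers of the single generators
  \<open>x_1, \<dots>, x_(n-1)\<close>, so an automorphism permutes these cyclic groups, and the power relations then
  force it to be trivial modulo \<open>W\<close>. The commutators that do not occur in a power relation may be
  permuted freely, and \<open>H\<close> acts regularly on some of those of the form \<open>[x_a, x_0]\<close>.\<close>

section \<open>Actions normalising the holomorph\<close>

lemma perm_group_simps:
  shows "carrier (perm_group S) = Bij S"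
    and "\<lbrakk>f \<in> Bij S; g \<in> Bij S\<rbrakk> \<Longrightarrow> f \<otimes>\<^bsub>perm_group S\<^esub> g = compose S g f"
    and "\<one>\<^bsub>perm_group S\<^esub> = (\<lambda>x\<in>S. x)"
  by (auto simp: perm_group_def BijGroup_def)

text \<open>Clearing the inverse leaves commutation equations, which become pointwise identities in
  a permutation group. Each conjunct is one inclusion between \<open>R\<close> and its conjugate.
  \<open>R\<close> is any subset, so that this serves the set of right translations as well as
  \<open>Hol G\<close>.\<close>

lemma (in group) mem_normalizer_iff:
  assumes R: "R \<subseteq> carrier G" and g: "g \<in> carrier G"
  shows "g \<in> normalizer G R \<longleftrightarrow>
    (\<forall>r\<in>R. \<exists>r'\<in>R. g \<otimes> r = r' \<otimes> g) \<and> (\<forall>r\<in>R. \<exists>r'\<in>R. r \<otimes> g = g \<otimes> r')"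
proof -
  have coset: "(g <# R) #> inv g = {g \<otimes> r \<otimes> inv g | r. r \<in> R}"
    by (auto simp: l_coset_def r_coset_def)
  have "g \<in> normalizer G R \<longleftrightarrow> (g <# R) #> inv g = R"
    using assms by (simp add: normalizer_def stabilizer_def)
  also have "\<dots> \<longleftrightarrow> (\<forall>r\<in>R. g \<otimes> r \<otimes> inv g \<in> R) \<and> (\<forall>r\<in>R. \<exists>r'\<in>R. r = g \<otimes> r' \<otimes> inv g)"
    unfolding coset by blast
  also have "(\<forall>r\<in>R. g \<otimes> r \<otimes> inv g \<in> R) \<longleftrightarrow> (\<forall>r\<in>R. \<exists>r'\<in>R. g \<otimes> r = r' \<otimes> g)"
  proof (intro ball_cong refl)
    fix r assume r: "r \<in> R"
    have "(g \<otimes> r = r' \<otimes> g) = (r' = g \<otimes> r \<otimes> inv g)" if "r' \<in> R" for r'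
      using that R r g by (subst inv_solve_right) auto
    then show "(g \<otimes> r \<otimes> inv g \<in> R) = (\<exists>r'\<in>R. g \<otimes> r = r' \<otimes> g)"
      by blast
  qed
  also have "(\<forall>r\<in>R. \<exists>r'\<in>R. r = g \<otimes> r' \<otimes> inv g) \<longleftrightarrow> (\<forall>r\<in>R. \<exists>r'\<in>R. r \<otimes> g = g \<otimes> r')"
  proof (intro ball_cong bex_cong refl)
    fix r r' assume "r \<in> R" "r' \<in> R"
    then show "(r = g \<otimes> r' \<otimes> inv g) = (r \<otimes> g = g \<otimes> r')"
      using R g by (subst inv_solve_right) auto
  qed
  finally show ?thesis .
qed

text \<open>The holomorph consists of automorphisms followed by right translations. If \<eta>
  normalises the translations, then \<eta>(xz) = \<eta>(x) z' with z' depending on z alone; taking x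
  = 1 identifies z', and dividing \<eta> by \<eta>(1) on the right leaves a multiplicative
  map.\<close>

lemma Hol_iff:
  fixes G (structure)
  assumes "group G"
  shows "\<eta> \<in> Hol G \<longleftrightarrow> \<eta> \<in> Bij (carrier G) \<and>
    (\<exists>\<alpha>\<in>iso G G. \<exists>y\<in>carrier G. \<forall>x\<in>carrier G. \<eta> x = \<alpha> x \<otimes> y)"
proof -
  interpret group G by fact
  interpret P: group "perm_group (carrier G)" by (rule group_perm_group)
  let ?R = "right_regular G ` carrier G"
  have R: "?R \<subseteq> carrier (perm_group (carrier G))"
    using right_regular_hom[OF assms] by (auto simp: hom_def)
  then have rB: "right_regular G y \<in> Bij (carrier G)" if "y \<in> carrier G" for y
    using that by (auto simp: perm_group_simps)
  have rr: "right_regular G y x = x \<otimes> y" if "x \<in> carrier G" for x y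
    using that by (simp add: right_regular_def)
  have compose_eq: "compose S g f = compose S g' f' \<longleftrightarrow> (\<forall>x\<in>S. g (f x) = g' (f' x))"
    for S :: "'a set" and f g f' g' :: "'a \<Rightarrow> 'a"
    by (auto simp: compose_def restrict_def fun_eq_iff)
  have char: "\<eta> \<in> Hol G \<longleftrightarrow>
      (\<forall>z\<in>carrier G. \<exists>z'\<in>carrier G. \<forall>x\<in>carrier G. \<eta> x \<otimes> z = \<eta> (x \<otimes> z')) \<and>
      (\<forall>z\<in>carrier G. \<exists>z'\<in>carrier G. \<forall>x\<in>carrier G. \<eta> (x \<otimes> z) = \<eta> x \<otimes> z')"
    if B: "\<eta> \<in> Bij (carrier G)"
  proof -
    have cl: "\<eta> x \<in> carrier G" if "x \<in> carrier G" for x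
      using that B Bij_imp_funcset by blast
    have "\<eta> \<in> carrier (perm_group (carrier G))" using B by (simp add: perm_group_simps)
    from P.mem_normalizer_iff[OF R this] show ?thesis
      by (simp add: Hol_def B rB cl rr perm_group_simps compose_eq)
  qed
  show ?thesis
  proof
    assume H: "\<eta> \<in> Hol G"
    then have B: "\<eta> \<in> Bij (carrier G)"
      by (auto simp: Hol_def normalizer_def stabilizer_def perm_group_simps)
    then have cl: "\<eta> x \<in> carrier G" if "x \<in> carrier G" for x
      using that Bij_imp_funcset by blast
    have *: "\<exists>z'\<in>carrier G. \<forall>x\<in>carrier G. \<eta> (x \<otimes> z) = \<eta> x \<otimes> z'" if z: "z \<in> carrier G" for z
      using H z char[OF B] by blast
    define \<alpha> where "\<alpha> = (\<lambda>x. \<eta> x \<otimes> inv (\<eta> \<one>))"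
    have mul: "\<eta> (x \<otimes> z) = \<eta> x \<otimes> inv (\<eta> \<one>) \<otimes> \<eta> z" if x: "x \<in> carrier G" and z: "z \<in> carrier G" for x z
    proof -
      obtain z' where z': "z' \<in> carrier G" "\<And>x. x \<in> carrier G \<Longrightarrow> \<eta> (x \<otimes> z) = \<eta> x \<otimes> z'"
        using *[OF z] by blast
      have "\<eta> z = \<eta> \<one> \<otimes> z'" using z'(2)[OF one_closed] z by simp
      then have "z' = inv (\<eta> \<one>) \<otimes> \<eta> z" using z' cl z by (simp add: inv_solve_left)
      then show ?thesis using z' x z cl by (simp add: m_assoc)
    qed
    have bij: "bij_betw \<eta> (carrier G) (carrier G)" using B by (simp add: Bij_def)
    have "bij_betw (\<lambda>x. right_regular G (inv (\<eta> \<one>)) (\<eta> x)) (carrier G) (carrier G)"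
      using bij_betw_trans[OF bij, of "right_regular G (inv (\<eta> \<one>))" "carrier G"] rB[of "inv (\<eta> \<one>)"] cl
      by (simp add: Bij_def comp_def)
    then have "bij_betw \<alpha> (carrier G) (carrier G)"
      by (rule bij_betw_cong[THEN iffD1, rotated]) (simp add: \<alpha>_def rr cl)
    then have "\<alpha> \<in> iso G G"
      using cl by (auto simp: iso_def hom_def \<alpha>_def mul m_assoc)
    moreover have "\<forall>x\<in>carrier G. \<eta> x = \<alpha> x \<otimes> \<eta> \<one>"
      using cl by (simp add: \<alpha>_def m_assoc)
    ultimately show "\<eta> \<in> Bij (carrier G) \<and> (\<exists>\<alpha>\<in>iso G G. \<exists>y\<in>carrier G. \<forall>x\<in>carrier G. \<eta> x = \<alpha> x \<otimes> y)"
      using B cl[OF one_closed] by blast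
  next
    assume "\<eta> \<in> Bij (carrier G) \<and> (\<exists>\<alpha>\<in>iso G G. \<exists>y\<in>carrier G. \<forall>x\<in>carrier G. \<eta> x = \<alpha> x \<otimes> y)"
    then obtain \<alpha> y where B: "\<eta> \<in> Bij (carrier G)" and \<alpha>: "\<alpha> \<in> iso G G" and y: "y \<in> carrier G"
      and \<eta>: "\<And>x. x \<in> carrier G \<Longrightarrow> \<eta> x = \<alpha> x \<otimes> y" by blast
    have \<alpha>c: "\<alpha> x \<in> carrier G" if "x \<in> carrier G" for x
      using \<alpha> that by (auto simp: iso_def hom_def)
    have \<alpha>m: "\<alpha> (x \<otimes> z) = \<alpha> x \<otimes> \<alpha> z" if "x \<in> carrier G" "z \<in> carrier G" for x z
      using \<alpha> that by (auto simp: iso_def hom_def)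
    have surj: "\<exists>x\<in>carrier G. \<alpha> x = z" if "z \<in> carrier G" for z
      using \<alpha> that unfolding iso_def bij_betw_def by (metis (mono_tags, lifting) imageE mem_Collect_eq)
    have 1: "\<exists>z'\<in>carrier G. \<forall>x\<in>carrier G. \<eta> x \<otimes> z = \<eta> (x \<otimes> z')" if z: "z \<in> carrier G" for z
    proof -
      \<comment> \<open>The translation by z, moved past y, becomes the translation by its conjugate
        under y; z' is the preimage of that conjugate.\<close>
      obtain z' where z': "z' \<in> carrier G" "\<alpha> z' = y \<otimes> z \<otimes> inv y" using surj[of "y \<otimes> z \<otimes> inv y"] y z by auto
      then show ?thesis using y z \<alpha>c \<alpha>m by (intro bexI[of _ z']) (auto simp: \<eta> m_assoc)
    qed
    have 2: "\<exists>z'\<in>carrier G. \<forall>x\<in>carrier G. \<eta> (x \<otimes> z) = \<eta> x \<otimes> z'" if z: "z \<in> carrier G" for z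
    proof (intro bexI ballI)
      show "inv y \<otimes> (\<alpha> z \<otimes> y) \<in> carrier G" using y z \<alpha>c by simp
      fix x assume x: "x \<in> carrier G"
      have "y \<otimes> (inv y \<otimes> (\<alpha> z \<otimes> y)) = \<alpha> z \<otimes> y" using y z \<alpha>c by (simp add: m_assoc[symmetric])
      then show "\<eta> (x \<otimes> z) = \<eta> x \<otimes> (inv y \<otimes> (\<alpha> z \<otimes> y))" using x y z \<alpha>c \<alpha>m by (simp add: \<eta> m_assoc)
    qed
    show "\<eta> \<in> Hol G"
      using 1 2 char[OF B] by blast
  qed
qed

text \<open>The last three conditions: \<open>\<theta> h\<close> carries right translations into the holomorph, it carries
  automorphisms to automorphisms, and it is itself an automorphism only for trivial \<open>h\<close>.\<close>

definition hol_action ::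
    "('a, 'b) monoid_scheme \<Rightarrow> ('h, 'c) monoid_scheme \<Rightarrow> ('h \<Rightarrow> 'a \<Rightarrow> 'a) \<Rightarrow> bool" where
  "hol_action G H \<theta> \<longleftrightarrow>
     (\<forall>h\<in>carrier H. \<forall>x\<in>carrier G. \<theta> h x \<in> carrier G) \<and>
     (\<forall>h\<in>carrier H. \<forall>k\<in>carrier H. \<forall>x\<in>carrier G. \<theta> (h \<otimes>\<^bsub>H\<^esub> k) x = \<theta> k (\<theta> h x)) \<and>
     (\<forall>x\<in>carrier G. \<theta> \<one>\<^bsub>H\<^esub> x = x) \<and>
     (\<forall>h\<in>carrier H. \<theta> h \<one>\<^bsub>G\<^esub> = \<one>\<^bsub>G\<^esub>) \<and>
     (\<forall>h\<in>carrier H. \<forall>y\<in>carrier G. \<exists>\<alpha>\<in>iso G G. \<forall>x\<in>carrier G.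
        \<theta> h (x \<otimes>\<^bsub>G\<^esub> y) = \<alpha> (\<theta> h x) \<otimes>\<^bsub>G\<^esub> \<theta> h y) \<and>
     (\<forall>h\<in>carrier H. \<forall>\<alpha>\<in>iso G G. \<exists>\<beta>\<in>iso G G. \<forall>x\<in>carrier G. \<theta> h (\<alpha> x) = \<beta> (\<theta> h x)) \<and>
     (\<forall>h\<in>carrier H. \<theta> h \<in> hom G G \<longrightarrow> h = \<one>\<^bsub>H\<^esub>)"

text \<open>An element of the holomorph is an automorphism followed by a translation, and the action
  is compatible with both, so each \<open>\<theta> h\<close> lies in \<open>NHol G\<close>. As
  \<open>\<theta> h\<close> fixes the identity, it lies in \<open>Hol G\<close> only if it is an
  automorphism, hence only for trivial \<open>h\<close>; so the map to the quotient is
  injective.\<close>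

lemma hol_action_embeds_T_group:
  assumes "group G" "group H" and act: "hol_action G H \<theta>"
  shows "\<exists>K. subgroup K (T_group G) \<and> H \<cong> (T_group G)\<lparr>carrier := K\<rparr>"
proof -
  interpret G: group G by fact
  interpret H: group H by fact
  let ?P = "perm_group (carrier G)"
  interpret P: group ?P by (rule group_perm_group)
  let ?N = "?P\<lparr>carrier := NHol G\<rparr>"
  interpret Hol: normal "Hol G" ?N by (rule Hol_normal_NHol) fact
  have cl: "\<theta> h x \<in> carrier G" if "h \<in> carrier H" "x \<in> carrier G" for h x
    using act that by (simp add: hol_action_def)
  have mult: "\<theta> (h \<otimes>\<^bsub>H\<^esub> k) x = \<theta> k (\<theta> h x)" if "h \<in> carrier H" "k \<in> carrier H" "x \<in> carrier G" for h k x
    using act that by (simp add: hol_action_def)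
  have one: "\<theta> \<one>\<^bsub>H\<^esub> x = x" if "x \<in> carrier G" for x
    using act that by (simp add: hol_action_def)
  have reg: "\<exists>\<alpha>\<in>iso G G. \<forall>x\<in>carrier G. \<theta> h (x \<otimes>\<^bsub>G\<^esub> y) = \<alpha> (\<theta> h x) \<otimes>\<^bsub>G\<^esub> \<theta> h y"
    if "h \<in> carrier H" "y \<in> carrier G" for h y
    using act that by (simp add: hol_action_def)
  have aut: "\<exists>\<beta>\<in>iso G G. \<forall>x\<in>carrier G. \<theta> h (\<alpha> x) = \<beta> (\<theta> h x)"
    if "h \<in> carrier H" "\<alpha> \<in> iso G G" for h \<alpha>
    using act that by (simp add: hol_action_def)
  have isoc: "\<alpha> x \<in> carrier G" if "\<alpha> \<in> iso G G" "x \<in> carrier G" for \<alpha> x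
    using that by (auto simp: iso_def hom_def)
  \<comment> \<open>Elements of \<open>Bij\<close> are undefined outside the carrier, so the action
    is restricted before it is compared with permutations.\<close>
  define \<Theta> where "\<Theta> = (\<lambda>h. restrict (\<theta> h) (carrier G))"
  have \<Theta>: "\<Theta> h x = \<theta> h x" if "x \<in> carrier G" for h x
    using that by (simp add: \<Theta>_def)
  have B: "\<Theta> h \<in> Bij (carrier G)" if h: "h \<in> carrier H" for h
  proof -
    have inv: "\<theta> (inv\<^bsub>H\<^esub> h) (\<theta> h x) = x \<and> \<theta> h (\<theta> (inv\<^bsub>H\<^esub> h) x) = x" if x: "x \<in> carrier G" for x
      using h x mult[of h "inv\<^bsub>H\<^esub> h" x] mult[of "inv\<^bsub>H\<^esub> h" h x] one[OF x] by simp
    have "bij_betw (\<theta> h) (carrier G) (carrier G)"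
      by (rule bij_betw_byWitness[where f' = "\<theta> (inv\<^bsub>H\<^esub> h)"]) (use h inv cl in auto)
    then show ?thesis by (simp add: Bij_def \<Theta>_def)
  qed
  have BP: "\<Theta> h \<in> carrier ?P" if "h \<in> carrier H" for h
    using B[OF that] by (simp add: perm_group_simps)
  have hom: "\<Theta> (h \<otimes>\<^bsub>H\<^esub> k) = \<Theta> h \<otimes>\<^bsub>?P\<^esub> \<Theta> k" if "h \<in> carrier H" "k \<in> carrier H" for h k
    using that B cl by (auto simp: perm_group_simps compose_def fun_eq_iff \<Theta>_def mult restrict_def)
  have \<Theta>1: "\<Theta> \<one>\<^bsub>H\<^esub> = \<one>\<^bsub>?P\<^esub>"
    by (auto simp: perm_group_simps \<Theta>_def one restrict_def)
  have HolB: "Hol G \<subseteq> carrier ?P"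
    using subgroup.subset[OF subgroup_Hol[OF \<open>group G\<close>]] .
  have conj: "\<exists>\<eta>'\<in>Hol G. \<eta> \<otimes>\<^bsub>?P\<^esub> \<Theta> h = \<Theta> h \<otimes>\<^bsub>?P\<^esub> \<eta>'" if h: "h \<in> carrier H" and \<eta>: "\<eta> \<in> Hol G" for h \<eta>
  proof -
    from \<eta> obtain \<alpha> y where \<eta>B: "\<eta> \<in> Bij (carrier G)" and \<alpha>: "\<alpha> \<in> iso G G" and y: "y \<in> carrier G"
      and \<eta>_eq: "\<And>x. x \<in> carrier G \<Longrightarrow> \<eta> x = \<alpha> x \<otimes>\<^bsub>G\<^esub> y"
      by (auto simp: Hol_iff[OF \<open>group G\<close>])
    obtain \<beta> where \<beta>: "\<beta> \<in> iso G G" "\<And>x. x \<in> carrier G \<Longrightarrow> \<theta> h (\<alpha> x) = \<beta> (\<theta> h x)"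
      using aut[OF h \<alpha>] by blast
    obtain \<gamma> where \<gamma>: "\<gamma> \<in> iso G G"
      "\<And>x. x \<in> carrier G \<Longrightarrow> \<theta> h (x \<otimes>\<^bsub>G\<^esub> y) = \<gamma> (\<theta> h x) \<otimes>\<^bsub>G\<^esub> \<theta> h y"
      using reg[OF h y] by blast
    define \<eta>' where "\<eta>' = inv\<^bsub>?P\<^esub> \<Theta> h \<otimes>\<^bsub>?P\<^esub> (\<eta> \<otimes>\<^bsub>?P\<^esub> \<Theta> h)"
    have \<eta>P: "\<eta> \<in> carrier ?P" using \<eta> HolB by blast
    have \<eta>'P: "\<eta>' \<in> carrier ?P" using \<eta>P BP[OF h] by (simp add: \<eta>'_def)
    have eq: "\<eta> \<otimes>\<^bsub>?P\<^esub> \<Theta> h = \<Theta> h \<otimes>\<^bsub>?P\<^esub> \<eta>'"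
      using \<eta>P BP[OF h] by (simp add: \<eta>'_def P.m_assoc[symmetric])
    have \<eta>'B: "\<eta>' \<in> Bij (carrier G)" using \<eta>'P by (simp add: perm_group_simps)
    \<comment> \<open>The conjugate \<open>\<eta>'\<close> is computed at points
      \<open>\<theta> h x\<close>, which exhaust the carrier: \<open>\<beta>\<close> comes from the
      automorphism part of \<open>\<eta>\<close>, and \<open>\<gamma>\<close> from its translation
      part.\<close>
    have *: "\<eta>' (\<theta> h x) = \<gamma> (\<beta> (\<theta> h x)) \<otimes>\<^bsub>G\<^esub> \<theta> h y" if x: "x \<in> carrier G" for x
    proof -
      have "\<theta> h (\<eta> x) = \<eta>' (\<theta> h x)"
        using fun_cong[OF eq, of x] x B[OF h] \<eta>B \<eta>'B \<Theta> Bij_imp_funcset[OF \<eta>B]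
        by (simp add: perm_group_simps compose_def Pi_iff)
      then show ?thesis
        using x y \<alpha> by (simp add: \<eta>_eq \<gamma>(2) \<beta>(2) isoc)
    qed
    have "\<eta>' z = (\<gamma> \<circ> \<beta>) z \<otimes>\<^bsub>G\<^esub> \<theta> h y" if z: "z \<in> carrier G" for z
    proof -
      have "\<theta> h (\<theta> (inv\<^bsub>H\<^esub> h) z) = z"
        using h z mult[of "inv\<^bsub>H\<^esub> h" h z] one[OF z] by simp
      then show ?thesis using *[of "\<theta> (inv\<^bsub>H\<^esub> h) z"] cl h z by simp
    qed
    moreover have "\<gamma> \<circ> \<beta> \<in> iso G G" using \<beta>(1) \<gamma>(1) by (rule iso_set_trans)
    ultimately have "\<eta>' \<in> Hol G"
      using \<eta>'B cl[OF h y] unfolding Hol_iff[OF \<open>group G\<close>] by blast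
    then show ?thesis using eq by blast
  qed
  have conj': "\<exists>\<eta>'\<in>Hol G. \<Theta> h \<otimes>\<^bsub>?P\<^esub> \<eta> = \<eta>' \<otimes>\<^bsub>?P\<^esub> \<Theta> h" if h: "h \<in> carrier H" and \<eta>: "\<eta> \<in> Hol G" for h \<eta>
  proof -
    \<comment> \<open>The opposite inclusion is \<open>conj\<close> for the inverse of
      \<open>h\<close>, multiplied by \<open>\<Theta> h\<close> on both sides.\<close>
    let ?k = "inv\<^bsub>H\<^esub> h"
    obtain \<eta>' where \<eta>': "\<eta>' \<in> Hol G" "\<eta> \<otimes>\<^bsub>?P\<^esub> \<Theta> ?k = \<Theta> ?k \<otimes>\<^bsub>?P\<^esub> \<eta>'"
      using conj[OF _ \<eta>, of ?k] h by auto
    have P: "\<eta> \<in> carrier ?P" "\<eta>' \<in> carrier ?P" using \<eta> \<eta>' HolB by auto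
    have k: "\<Theta> h \<otimes>\<^bsub>?P\<^esub> \<Theta> ?k = \<one>\<^bsub>?P\<^esub>" "\<Theta> ?k \<otimes>\<^bsub>?P\<^esub> \<Theta> h = \<one>\<^bsub>?P\<^esub>"
      using h by (simp_all add: hom[symmetric] \<Theta>1)
    have "\<Theta> h \<otimes>\<^bsub>?P\<^esub> \<eta> = \<Theta> h \<otimes>\<^bsub>?P\<^esub> (\<eta> \<otimes>\<^bsub>?P\<^esub> \<Theta> ?k) \<otimes>\<^bsub>?P\<^esub> \<Theta> h"
      using P BP h k by (simp add: P.m_assoc)
    also have "\<dots> = \<Theta> h \<otimes>\<^bsub>?P\<^esub> \<Theta> ?k \<otimes>\<^bsub>?P\<^esub> \<eta>' \<otimes>\<^bsub>?P\<^esub> \<Theta> h"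
      unfolding \<eta>'(2) using P BP h by (simp add: P.m_assoc)
    also have "\<dots> = \<eta>' \<otimes>\<^bsub>?P\<^esub> \<Theta> h"
      using P BP h k by simp
    finally show ?thesis using \<eta>'(1) by blast
  qed
  have N: "\<Theta> h \<in> NHol G" if h: "h \<in> carrier H" for h
    unfolding NHol_def P.mem_normalizer_iff[OF HolB BP[OF h]]
    using conj[OF h] conj'[OF h] by blast
  have "\<Theta> \<in> hom H ?N"
    using N hom by (auto simp: hom_def)
  moreover have "(\<lambda>a. Hol G #>\<^bsub>?N\<^esub> a) \<in> hom ?N (T_group G)"
    using Hol.r_coset_hom_Mod by (simp add: T_group_def)
  ultimately have \<psi>: "(\<lambda>a. Hol G #>\<^bsub>?N\<^esub> a) \<circ> \<Theta> \<in> hom H (T_group G)" (is "?\<psi> \<in> _")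
    by (rule Group.hom_compose)
  interpret \<psi>: group_hom H "T_group G" ?\<psi>
    using \<psi> group_T_group[OF \<open>group G\<close>] by (simp add: group_hom_def group_hom_axioms_def \<open>group H\<close>)
  have "h = \<one>\<^bsub>H\<^esub>" if h: "h \<in> carrier H" and ker: "?\<psi> h = \<one>\<^bsub>T_group G\<^esub>" for h
  proof -
    have "Hol G #>\<^bsub>?N\<^esub> \<Theta> h = Hol G"
      using ker by (simp add: T_group_def FactGroup_def)
    then have "\<Theta> h \<in> Hol G"
      using Hol.coset_join1[OF _ _ Hol.is_subgroup] N[OF h] by simp
    then obtain \<alpha> y where \<alpha>: "\<alpha> \<in> iso G G" and y: "y \<in> carrier G"
      and eq: "\<And>x. x \<in> carrier G \<Longrightarrow> \<theta> h x = \<alpha> x \<otimes>\<^bsub>G\<^esub> y"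
      by (auto simp: Hol_iff[OF \<open>group G\<close>] \<Theta>)
    have \<alpha>h: "\<alpha> \<in> hom G G" using \<alpha> by (simp add: iso_def)
    have "\<theta> h \<one>\<^bsub>G\<^esub> = \<one>\<^bsub>G\<^esub>" using act h by (simp add: hol_action_def)
    then have "y = \<one>\<^bsub>G\<^esub>" using eq[OF G.one_closed] y hom_one[OF \<alpha>h] G.group_axioms by simp
    then have "\<theta> h x = \<alpha> x" if "x \<in> carrier G" for x
      using eq that isoc[OF \<alpha>] by simp
    then have "\<theta> h \<in> hom G G"
      using \<alpha>h by (auto simp: hom_def)
    then show ?thesis using act h by (simp add: hol_action_def)
  qed
  then have inj: "inj_on ?\<psi> (carrier H)"
    using \<psi>.inj_on_one_iff by blast
  have "?\<psi> \<in> iso H ((T_group G)\<lparr>carrier := ?\<psi> ` carrier H\<rparr>)"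
    using inj \<psi> by (auto simp: iso_def hom_def bij_betw_def)
  then show ?thesis
    using \<psi>.img_is_subgroup unfolding is_iso_def by blast
qed

text \<open>Conjugation by \<open>f\<close> preserves each of the conditions. This carries the
  action to a copy of the group whose elements are natural numbers, the type demanded in the
  end.\<close>

lemma hol_action_iso:
  assumes "group G" "group G'" "group H" and f: "f \<in> iso G G'" and act: "hol_action G H \<theta>"
  shows "hol_action G' H (\<lambda>h. f \<circ> \<theta> h \<circ> inv_into (carrier G) f)"
proof -
  let ?g = "inv_into (carrier G) f"
  have g: "?g \<in> iso G' G" using group.iso_set_sym[OF \<open>group G\<close> f] .
  have bij: "bij_betw f (carrier G) (carrier G')" using f by (simp add: iso_def)
  have gf [simp]: "?g (f x) = x" if "x \<in> carrier G" for x
    using bij that by (simp add: bij_betw_inv_into_left)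
  have fg [simp]: "f (?g x) = x" if "x \<in> carrier G'" for x
    using bij that by (simp add: bij_betw_inv_into_right)
  have fc [simp]: "f x \<in> carrier G'" if "x \<in> carrier G" for x
    using f that by (auto simp: iso_def hom_def)
  have gc [simp]: "?g x \<in> carrier G" if "x \<in> carrier G'" for x
    using g that by (auto simp: iso_def hom_def)
  have fm [simp]: "f (x \<otimes>\<^bsub>G\<^esub> y) = f x \<otimes>\<^bsub>G'\<^esub> f y" if "x \<in> carrier G" "y \<in> carrier G" for x y
    using f that by (auto simp: iso_def hom_def)
  have gm [simp]: "?g (x \<otimes>\<^bsub>G'\<^esub> y) = ?g x \<otimes>\<^bsub>G\<^esub> ?g y" if "x \<in> carrier G'" "y \<in> carrier G'" for x y
    using g that by (auto simp: iso_def hom_def)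
  have f1: "f \<one>\<^bsub>G\<^esub> = \<one>\<^bsub>G'\<^esub>" using f assms by (auto simp: iso_def intro!: hom_one)
  have g1: "?g \<one>\<^bsub>G'\<^esub> = \<one>\<^bsub>G\<^esub>" using g assms by (auto simp: iso_def intro!: hom_one)
  have isoc: "\<alpha> x \<in> carrier G" if "\<alpha> \<in> iso G G" "x \<in> carrier G" for \<alpha> x
    using that by (auto simp: iso_def hom_def)
  have up: "f \<circ> \<alpha> \<circ> ?g \<in> iso G' G'" if "\<alpha> \<in> iso G G" for \<alpha>
    using iso_set_trans[OF iso_set_trans[OF g that] f] by (simp add: comp_assoc)
  have down: "?g \<circ> \<alpha> \<circ> f \<in> iso G G" if "\<alpha> \<in> iso G' G'" for \<alpha>
    using iso_set_trans[OF iso_set_trans[OF f that] g] by (simp add: comp_assoc)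
  have cl: "\<theta> h x \<in> carrier G" if "h \<in> carrier H" "x \<in> carrier G" for h x
    using act that by (simp add: hol_action_def)
  have reg: "\<exists>\<alpha>\<in>iso G G. \<forall>x\<in>carrier G. \<theta> h (x \<otimes>\<^bsub>G\<^esub> y) = \<alpha> (\<theta> h x) \<otimes>\<^bsub>G\<^esub> \<theta> h y"
    if "h \<in> carrier H" "y \<in> carrier G" for h y
    using act that by (simp add: hol_action_def)
  have aut: "\<exists>\<beta>\<in>iso G G. \<forall>x\<in>carrier G. \<theta> h (\<alpha> x) = \<beta> (\<theta> h x)"
    if "h \<in> carrier H" "\<alpha> \<in> iso G G" for h \<alpha>
    using act that by (simp add: hol_action_def)
  show ?thesis
    unfolding hol_action_def
  proof (intro conjI ballI impI)
    fix h y assume h: "h \<in> carrier H" and y: "y \<in> carrier G'"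
    obtain \<alpha> where \<alpha>: "\<alpha> \<in> iso G G"
      "\<And>x. x \<in> carrier G \<Longrightarrow> \<theta> h (x \<otimes>\<^bsub>G\<^esub> ?g y) = \<alpha> (\<theta> h x) \<otimes>\<^bsub>G\<^esub> \<theta> h (?g y)"
      using reg[OF h gc[OF y]] by blast
    show "\<exists>\<alpha>\<in>iso G' G'. \<forall>x\<in>carrier G'. (f \<circ> \<theta> h \<circ> ?g) (x \<otimes>\<^bsub>G'\<^esub> y) =
        \<alpha> ((f \<circ> \<theta> h \<circ> ?g) x) \<otimes>\<^bsub>G'\<^esub> (f \<circ> \<theta> h \<circ> ?g) y"
      by (rule bexI[OF _ up[OF \<alpha>(1)]]) (use h y \<alpha> cl isoc in auto)
  next
    fix h \<alpha> assume h: "h \<in> carrier H" and \<alpha>: "\<alpha> \<in> iso G' G'"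
    then obtain \<beta> where \<beta>: "\<beta> \<in> iso G G"
      "\<And>x. x \<in> carrier G \<Longrightarrow> \<theta> h (?g (\<alpha> (f x))) = \<beta> (\<theta> h x)"
      using aut[OF h down[OF \<alpha>]] by auto
    have "\<alpha> x \<in> carrier G'" if "x \<in> carrier G'" for x
      using that \<alpha> by (auto simp: iso_def hom_def)
    then show "\<exists>\<beta>\<in>iso G' G'. \<forall>x\<in>carrier G'. (f \<circ> \<theta> h \<circ> ?g) (\<alpha> x) = \<beta> ((f \<circ> \<theta> h \<circ> ?g) x)"
      by (intro bexI[OF _ up[OF \<beta>(1)]]) (use h \<beta>(2)[of "?g _", symmetric] cl in auto)
  next
    fix h assume h: "h \<in> carrier H" and hom: "f \<circ> \<theta> h \<circ> ?g \<in> hom G' G'"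
    have "f \<in> hom G G'" "?g \<in> hom G' G" using f g by (auto simp: iso_def)
    with hom have "?g \<circ> (f \<circ> \<theta> h \<circ> ?g) \<circ> f \<in> hom G G"
      by (metis Group.hom_compose)
    then have "\<theta> h \<in> hom G G"
      by (rule group.hom_restrict[OF \<open>group G\<close>]) (use cl h in auto)
    then show "h = \<one>\<^bsub>H\<^esub>" using act h by (simp add: hol_action_def)
  qed (use act in \<open>auto simp: hol_action_def f1 g1\<close>)
qed

section \<open>Groups of class two\<close>

text \<open>All commutators lie in the central set \<open>Z\<close>, so the series stops after two
  steps, and a noncommuting pair prevents it from stopping earlier. \<open>Z\<close> need not be a
  subgroup, so centrality is passed to the generated subgroup by induction.\<close>

lemma (in group) has_nilpotency_class_2I:
  assumes Z: "Z \<subseteq> carrier G" "\<And>z x. z \<in> Z \<Longrightarrow> x \<in> carrier G \<Longrightarrow> z \<otimes> x = x \<otimes> z"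
    and comm: "\<And>x y. x \<in> carrier G \<Longrightarrow> y \<in> carrier G \<Longrightarrow> \<exists>z\<in>Z. x \<otimes> y = z \<otimes> (y \<otimes> x)"
    and xy: "x \<in> carrier G" "y \<in> carrier G" "x \<otimes> y \<noteq> y \<otimes> x"
  shows "has_nilpotency_class G 2"
proof -
  let ?C = "{h \<otimes> g \<otimes> inv h \<otimes> inv g | h g. h \<in> carrier G \<and> g \<in> carrier G}"
  have CZ: "?C \<subseteq> Z"
  proof safe
    fix h g assume hg: "h \<in> carrier G" "g \<in> carrier G"
    then obtain z where z: "z \<in> Z" "h \<otimes> g = z \<otimes> (g \<otimes> h)" using comm by blast
    then have "h \<otimes> g \<otimes> inv h \<otimes> inv g = z"
      using hg Z(1) by (auto simp: m_assoc subset_iff)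
    then show "h \<otimes> g \<otimes> inv h \<otimes> inv g \<in> Z" using z by simp
  qed
  have central: "z \<in> carrier G \<and> (\<forall>x\<in>carrier G. z \<otimes> x = x \<otimes> z)" if "z \<in> generate G ?C" for z
    using that
  proof induction
    case (inv h)
    then have h: "h \<in> carrier G" "\<forall>x\<in>carrier G. h \<otimes> x = x \<otimes> h" using CZ Z by blast+
    have "inv h \<otimes> x = x \<otimes> inv h" if x: "x \<in> carrier G" for x
    proof -
      have "inv h \<otimes> x = inv h \<otimes> (x \<otimes> h) \<otimes> inv h" using h(1) x by (simp add: m_assoc)
      also have "x \<otimes> h = h \<otimes> x" using h x by simp
      also have "inv h \<otimes> (h \<otimes> x) \<otimes> inv h = x \<otimes> inv h"
        using h(1) x by (simp add: m_assoc[symmetric])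
      finally show ?thesis .
    qed
    then show ?case using h by blast
  next
    case (eng h1 h2)
    have "h1 \<otimes> h2 \<otimes> x = x \<otimes> (h1 \<otimes> h2)" if x: "x \<in> carrier G" for x
    proof -
      have h: "h1 \<in> carrier G" "h2 \<in> carrier G" and 1: "h1 \<otimes> x = x \<otimes> h1" and 2: "h2 \<otimes> x = x \<otimes> h2"
        using eng x by blast+
      have "h1 \<otimes> h2 \<otimes> x = h1 \<otimes> (x \<otimes> h2)" unfolding 2[symmetric] using h x by (simp only: m_assoc)
      also have "\<dots> = x \<otimes> h1 \<otimes> h2" unfolding 1[symmetric] using h x by (simp only: m_assoc)
      finally show ?thesis using h x by (simp only: m_assoc)
    qed
    then show ?case using eng by blast
  next
    case (incl h)
    then show ?case using CZ Z by blast
  qed simp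
  have "h \<otimes> g \<otimes> inv h \<otimes> inv g = \<one>" if "h \<in> generate G ?C" "g \<in> carrier G" for h g
  proof -
    have h: "h \<in> carrier G" and "h \<otimes> g = g \<otimes> h" using central[OF that(1)] that(2) by blast+
    then have "h \<otimes> g \<otimes> inv h \<otimes> inv g = g \<otimes> h \<otimes> inv h \<otimes> inv g" by (simp only:)
    also have "\<dots> = \<one>" using h that(2) by (simp add: m_assoc)
    finally show ?thesis .
  qed
  moreover have "\<one> \<in> generate G ?C" by (rule generate.one)
  ultimately have "{h \<otimes> g \<otimes> inv h \<otimes> inv g | h g. h \<in> generate G ?C \<and> g \<in> carrier G} = {\<one>}"
    by (auto intro!: exI[of _ \<one>])
  then have 2: "lower_central G 2 = {\<one>}"
    by (simp add: numeral_2_eq_2 generate_one)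
  have "x \<otimes> y \<otimes> inv x \<otimes> inv y \<noteq> \<one>"
  proof
    assume "x \<otimes> y \<otimes> inv x \<otimes> inv y = \<one>"
    then have "y = x \<otimes> y \<otimes> inv x" using xy inv_solve_right[of \<one> "x \<otimes> y \<otimes> inv x" y] by simp
    then show False using xy inv_solve_right[of y "x \<otimes> y" x] by simp
  qed
  moreover have "x \<otimes> y \<otimes> inv x \<otimes> inv y \<in> lower_central G 1"
    using xy by (auto intro!: generate.incl)
  ultimately have "lower_central G 1 \<noteq> {\<one>}" by blast
  moreover have "lower_central G 0 \<noteq> {\<one>}" using xy by auto
  ultimately show ?thesis
    using 2 by (auto simp: has_nilpotency_class_def less_2_cases_iff)
qed

lemma (in group) lower_central_subset: "lower_central G i \<subseteq> carrier G"
proof (induction i)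
  case (Suc i)
  then show ?case unfolding lower_central.simps by (intro generate_incl) blast
qed simp

lemma lower_central_iso:
  assumes "group G" "group G'" and f: "f \<in> iso G G'"
  shows "lower_central G' i = f ` lower_central G i"
proof -
  interpret G: group G by fact
  interpret f: group_hom G G' f
    using assms by (simp add: group_hom_def group_hom_axioms_def iso_def)
  have surj: "f ` carrier G = carrier G'" using f by (simp add: iso_def bij_betw_def)
  show ?thesis
  proof (induction i)
    case 0 show ?case using surj by simp
  next
    case (Suc i)
    let ?C = "{h \<otimes>\<^bsub>G\<^esub> g \<otimes>\<^bsub>G\<^esub> inv\<^bsub>G\<^esub> h \<otimes>\<^bsub>G\<^esub> inv\<^bsub>G\<^esub> g | h g. h \<in> lower_central G i \<and> g \<in> carrier G}"
    have sub: "h \<in> carrier G" if "h \<in> lower_central G i" for h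
      using that G.lower_central_subset by blast
    have hom: "f (h \<otimes>\<^bsub>G\<^esub> g \<otimes>\<^bsub>G\<^esub> inv\<^bsub>G\<^esub> h \<otimes>\<^bsub>G\<^esub> inv\<^bsub>G\<^esub> g) = f h \<otimes>\<^bsub>G'\<^esub> f g \<otimes>\<^bsub>G'\<^esub> inv\<^bsub>G'\<^esub> f h \<otimes>\<^bsub>G'\<^esub> inv\<^bsub>G'\<^esub> f g"
      if "h \<in> lower_central G i" "g \<in> carrier G" for h g
      using that sub by simp
    have "lower_central G' (Suc i) = generate G' {h \<otimes>\<^bsub>G'\<^esub> g \<otimes>\<^bsub>G'\<^esub> inv\<^bsub>G'\<^esub> h \<otimes>\<^bsub>G'\<^esub> inv\<^bsub>G'\<^esub> g | h g.
        h \<in> f ` lower_central G i \<and> g \<in> f ` carrier G}"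
      using Suc surj by simp
    also have "{h \<otimes>\<^bsub>G'\<^esub> g \<otimes>\<^bsub>G'\<^esub> inv\<^bsub>G'\<^esub> h \<otimes>\<^bsub>G'\<^esub> inv\<^bsub>G'\<^esub> g | h g. h \<in> f ` lower_central G i \<and> g \<in> f ` carrier G} = f ` ?C"
    proof (intro equalityI subsetI)
      fix z assume "z \<in> {h \<otimes>\<^bsub>G'\<^esub> g \<otimes>\<^bsub>G'\<^esub> inv\<^bsub>G'\<^esub> h \<otimes>\<^bsub>G'\<^esub> inv\<^bsub>G'\<^esub> g | h g. h \<in> f ` lower_central G i \<and> g \<in> f ` carrier G}"
      then obtain h g where "h \<in> lower_central G i" "g \<in> carrier G"
        "z = f h \<otimes>\<^bsub>G'\<^esub> f g \<otimes>\<^bsub>G'\<^esub> inv\<^bsub>G'\<^esub> f h \<otimes>\<^bsub>G'\<^esub> inv\<^bsub>G'\<^esub> f g" by blast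
      then show "z \<in> f ` ?C" using hom[symmetric] by blast
    next
      fix z assume "z \<in> f ` ?C"
      then obtain h g where hg: "h \<in> lower_central G i" "g \<in> carrier G"
        "z = f (h \<otimes>\<^bsub>G\<^esub> g \<otimes>\<^bsub>G\<^esub> inv\<^bsub>G\<^esub> h \<otimes>\<^bsub>G\<^esub> inv\<^bsub>G\<^esub> g)" by blast
      then show "z \<in> {h \<otimes>\<^bsub>G'\<^esub> g \<otimes>\<^bsub>G'\<^esub> inv\<^bsub>G'\<^esub> h \<otimes>\<^bsub>G'\<^esub> inv\<^bsub>G'\<^esub> g | h g. h \<in> f ` lower_central G i \<and> g \<in> f ` carrier G}"
        using hom[OF hg(1,2)] by blast
    qed
    also have "generate G' (f ` ?C) = f ` generate G ?C"
      by (rule f.generate_img) (use sub in auto)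
    finally show ?case by simp
  qed
qed

lemma has_nilpotency_class_iso:
  assumes "group G" "group G'" and f: "f \<in> iso G G'"
  shows "has_nilpotency_class G' c \<longleftrightarrow> has_nilpotency_class G c"
proof -
  interpret G: group G by fact
  have inj: "inj_on f (carrier G)" and one: "f \<one>\<^bsub>G\<^esub> = \<one>\<^bsub>G'\<^esub>"
    using f hom_one[of f G G'] assms by (auto simp: iso_def bij_betw_def)
  have "lower_central G' i = {\<one>\<^bsub>G'\<^esub>} \<longleftrightarrow> lower_central G i = {\<one>\<^bsub>G\<^esub>}" for i
    using inj_on_image_eq_iff[OF inj G.lower_central_subset, of "{\<one>\<^bsub>G\<^esub>}" i] one
    by (simp add: lower_central_iso[OF assms])
  then show ?thesis by (simp add: has_nilpotency_class_def)
qed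

section \<open>Rigidity of the power-commutator relations\<close>

text \<open>If \<open>u\<close>, \<open>v\<close>, \<open>w\<close> are the exponent vectors of \<open>x\<close>, \<open>y\<close>, \<open>z\<close>, this is the relation \<open>[x, y] = z^p\<close>,
  read off at every commutator of two generators.\<close>

definition pc_rel :: "nat \<Rightarrow> int \<Rightarrow> (nat \<Rightarrow> int) \<Rightarrow> (nat \<Rightarrow> int) \<Rightarrow> (nat \<Rightarrow> int) \<Rightarrow> bool" where
  "pc_rel n q u v w \<longleftrightarrow>
     (\<forall>i. 1 \<le> i \<longrightarrow> i < n \<longrightarrow> q dvd u i * v (i - 1) - u (i - 1) * v i - w i) \<and>
     q dvd u (n - 1) * v 1 - u 1 * v (n - 1) - w 0 \<and>
     (\<forall>a b. b + 2 \<le> a \<longrightarrow> a < n \<longrightarrow> (a, b) \<noteq> (n - 1, 1) \<longrightarrow> q dvd u a * v b - u b * v a)"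

text \<open>This treats [x, y] = x^p. Let m be the first index with nonzero exponent modulo
  \<open>q\<close>. If m is positive, the coordinate (m, m - 1) forces v to be 1 at m - 1, and then
  the coordinates (a, m - 1) kill the exponents at all a > m.\<close>

lemma pc_rel_self_support:
  assumes q: "Factorial_Ring.prime q" and n: "n \<ge> 4" and rel: "pc_rel n q u v u" and nz: "\<exists>i<n. \<not> q dvd u i"
  shows "\<exists>m. 1 \<le> m \<and> m < n \<and> \<not> q dvd u m \<and> (\<forall>i<n. i \<noteq> m \<longrightarrow> q dvd u i)"
proof -
  have adj: "q dvd u i * v (i - 1) - u (i - 1) * v i - u i" if "1 \<le> i" "i < n" for i
    using rel that by (simp add: pc_rel_def)
  have spec: "q dvd u (n - 1) * v 1 - u 1 * v (n - 1) - u 0"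
    using rel by (simp add: pc_rel_def)
  have far: "q dvd u a * v b - u b * v a" if "b + 2 \<le> a" "a < n" "(a, b) \<noteq> (n - 1, 1)" for a b
    using rel that by (simp add: pc_rel_def)
  define m where "m = (LEAST i. i < n \<and> \<not> q dvd u i)"
  have m: "m < n" "\<not> q dvd u m"
    using LeastI_ex[OF nz] by (auto simp: m_def)
  have below: "q dvd u i" if "i < m" for i
    using not_less_Least[of i "\<lambda>i. i < n \<and> \<not> q dvd u i"] that m(1) by (auto simp: m_def)
  \<comment> \<open>If m = 0, the coordinates (n - 1, 0) and (n - 2, 0), where no power occurs
    because n - 2 is at least 2, make the minor at (n - 1, n - 2) vanish, so u vanishes at n - 1.
    Then v vanishes there too, and the coordinate (n - 1, 1) gives the contradiction that u vanishes
    at 0.\<close>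
  have "m \<noteq> 0"
  proof
    assume m0: "m = 0"
    have f: "q dvd u b * v 0 - u 0 * v b" if "2 \<le> b" "b < n" for b
      using far[of 0 b] that by simp
    have f1: "q dvd u (n - 1) * v 0 - u 0 * v (n - 1)" and f2: "q dvd u (n - 2) * v 0 - u 0 * v (n - 2)"
      using n by (auto intro!: f)
    have f3: "q dvd u (n - 1) * v (n - 2) - u (n - 2) * v (n - 1) - u (n - 1)"
      using adj[of "n - 1"] n by (simp add: numeral_eq_Suc)
    have "u 0 * u (n - 1) =
        u (n - 2) * (u (n - 1) * v 0 - u 0 * v (n - 1))
        - u (n - 1) * (u (n - 2) * v 0 - u 0 * v (n - 2))
        - u 0 * (u (n - 1) * v (n - 2) - u (n - 2) * v (n - 1) - u (n - 1))"
      by (simp add: algebra_simps)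
    also have "q dvd \<dots>" by (intro dvd_diff dvd_mult f1 f2 f3)
    finally have 1: "q dvd u (n - 1)" using m m0 q by (simp add: prime_dvd_mult_iff)
    have "u 0 * v (n - 1) = u (n - 1) * v 0 - (u (n - 1) * v 0 - u 0 * v (n - 1))" by simp
    also have "q dvd \<dots>" by (intro dvd_diff dvd_mult2 f1 1)
    finally have 2: "q dvd v (n - 1)" using m m0 q by (simp add: prime_dvd_mult_iff)
    have "u 0 = u (n - 1) * v 1 - u 1 * v (n - 1) - (u (n - 1) * v 1 - u 1 * v (n - 1) - u 0)" by simp
    also have "q dvd \<dots>" by (intro dvd_diff dvd_mult2[OF 1] dvd_mult[OF 2] spec)
    finally have "q dvd u 0" .
    then show False using m m0 by simp
  qed
  then have m1: "1 \<le> m" by simp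
  have below1: "q dvd u (m - 1)" using below[of "m - 1"] m1 by simp
  have "u m * (v (m - 1) - 1) = (u m * v (m - 1) - u (m - 1) * v m - u m) + u (m - 1) * v m"
    by (simp add: algebra_simps)
  also have "q dvd \<dots>" by (intro dvd_add dvd_mult2 below1 adj m1 m)
  finally have v: "q dvd v (m - 1) - 1" using m q by (simp add: prime_dvd_mult_iff)
  have "q dvd u a" if a: "m < a" "a < n" for a
  proof -
    have "q dvd u a * v (m - 1) - u (m - 1) * v a"
    \<comment> \<open>For m = 2 and a = n - 1 the pair is the exceptional one. Its power term is
      \<open>u 0\<close>, which vanishes since 0 < m.\<close>
    proof (cases "(a, m - 1) = (n - 1, 1)")
      case True
      have "q dvd u (n - 1) * v 1 - u 1 * v (n - 1)"
        by (rule zdvd_zdiffD[OF spec below]) (use m1 in simp)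
      then show ?thesis using True by auto
    next
      case False then show ?thesis using far[of "m - 1" a] a m1 by auto
    qed
    then have 1: "q dvd u a * v (m - 1)" by (rule zdvd_zdiffD[OF _ dvd_mult2[OF below1]])
    have "u a = u a * v (m - 1) - u a * (v (m - 1) - 1)" by (simp add: algebra_simps)
    also have "q dvd \<dots>" by (intro dvd_diff dvd_mult v 1)
    finally show ?thesis .
  qed
  then have "q dvd u i" if "i < n" "i \<noteq> m" for i
    using below that by (meson linorder_neqE_nat)
  then show ?thesis using m m1 by blast
qed

text \<open>The vector \<open>g i\<close> stands for the exponents of the image of the i-th
  generator. For positive i it has a single nonzero entry, at \<open>\<tau> i\<close>; the relations
  turn \<open>\<tau>\<close> into a shift, and the range 1, ..., n - 1 leaves room only for the
  identity. The relations for generators 1 and 0 then determine \<open>g 0\<close> and the last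
  diagonal entry.\<close>

lemma pc_rel_rigid:
  fixes g :: "nat \<Rightarrow> nat \<Rightarrow> int"
  assumes q: "Factorial_Ring.prime q" and n: "n \<ge> 4" and nz: "\<And>i. i < n \<Longrightarrow> \<exists>j<n. \<not> q dvd g i j"
    and rel: "\<And>i. 1 \<le> i \<Longrightarrow> i < n \<Longrightarrow> pc_rel n q (g i) (g (i - 1)) (g i)"
    and rel0: "pc_rel n q (g (n - 1)) (g 1) (g 0)"
    and i: "i < n" and j: "j < n"
  shows "[g i j = of_bool (i = j)] (mod q)"
proof -
  have "\<forall>i. \<exists>m. 1 \<le> i \<longrightarrow> i < n \<longrightarrow> 1 \<le> m \<and> m < n \<and> \<not> q dvd g i m \<and> (\<forall>j<n. j \<noteq> m \<longrightarrow> q dvd g i j)"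
    using pc_rel_self_support[OF q n rel nz] by blast
  then obtain \<tau> where "\<forall>i. 1 \<le> i \<longrightarrow> i < n \<longrightarrow> 1 \<le> \<tau> i \<and> \<tau> i < n \<and> \<not> q dvd g i (\<tau> i) \<and>
      (\<forall>j<n. j \<noteq> \<tau> i \<longrightarrow> q dvd g i j)"
    by metis
  then have \<tau>: "1 \<le> \<tau> i" "\<tau> i < n" "\<not> q dvd g i (\<tau> i)"
    and off: "\<And>j. j < n \<Longrightarrow> j \<noteq> \<tau> i \<Longrightarrow> q dvd g i j" if "1 \<le> i" "i < n" for i
    using that by auto
  have not1: "\<not> q dvd 1" using q by auto
  \<comment> \<open>The bound 2 ensures that \<open>g (i - 1)\<close> has a single nonzero entry as
    well. At the pair (\<open>\<tau> i\<close>, \<open>\<tau> i - 1\<close>) the relation says that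
    \<open>g (i - 1)\<close> is 1 at \<open>\<tau> i - 1\<close>, so this index is its
    support.\<close>
  have step: "\<tau> i = \<tau> (i - 1) + 1 \<and> q dvd g (i - 1) (\<tau> (i - 1)) - 1" if i: "2 \<le> i" "i < n" for i
  proof -
    have t: "1 \<le> \<tau> i" "\<tau> i < n" "\<not> q dvd g i (\<tau> i)" using \<tau>[of i] i by auto
    have "q dvd g i (\<tau> i) * g (i - 1) (\<tau> i - 1) - g i (\<tau> i - 1) * g (i - 1) (\<tau> i) - g i (\<tau> i)"
      using rel[of i] i t by (simp add: pc_rel_def)
    moreover have "q dvd g i (\<tau> i - 1) * g (i - 1) (\<tau> i)" using off[of i "\<tau> i - 1"] i t by auto
    moreover have "g i (\<tau> i) * (g (i - 1) (\<tau> i - 1) - 1) =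
      (g i (\<tau> i) * g (i - 1) (\<tau> i - 1) - g i (\<tau> i - 1) * g (i - 1) (\<tau> i) - g i (\<tau> i))
      + g i (\<tau> i - 1) * g (i - 1) (\<tau> i)" by (simp add: algebra_simps)
    ultimately have "q dvd g i (\<tau> i) * (g (i - 1) (\<tau> i - 1) - 1)"
      by (metis dvd_add)
    then have *: "q dvd g (i - 1) (\<tau> i - 1) - 1" using t q by (simp add: prime_dvd_mult_iff)
    have "\<tau> i - 1 = \<tau> (i - 1)"
    proof (rule ccontr)
      assume "\<tau> i - 1 \<noteq> \<tau> (i - 1)"
      then have "q dvd g (i - 1) (\<tau> i - 1)" using off[of "i - 1" "\<tau> i - 1"] i t by auto
      then show False using * not1 dvd_diff[of q "g (i - 1) (\<tau> i - 1)" "g (i - 1) (\<tau> i - 1) - 1"] by simp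
    qed
    then show ?thesis using * t by auto
  qed
  have \<tau>_shift: "\<tau> (Suc i) = \<tau> 1 + i" if "Suc i < n" for i
    using that
  proof (induction i)
    case (Suc i) then show ?case using step[of "Suc (Suc i)"] by simp
  qed simp
  have "Suc (n - 2) = n - 1" using n by simp
  then have "\<tau> (n - 1) = \<tau> 1 + (n - 2)" using \<tau>_shift[of "n - 2"] n by simp
  moreover have "\<tau> (n - 1) < n" "1 \<le> \<tau> 1" using \<tau>[of "n - 1"] \<tau>[of 1] n by simp_all
  ultimately have "\<tau> 1 = 1" using n by linarith
  then have \<tau>_id: "\<tau> i = i" if "1 \<le> i" "i < n" for i
    using \<tau>_shift[of "i - 1"] that by simp
  have off': "q dvd g i j" if "1 \<le> i" "i < n" "j < n" "j \<noteq> i" for i j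
    using off[OF that(1,2,3)] that \<tau>_id by simp
  \<comment> \<open>The entry at i is read off the relation for i + 1, so i = n - 1 is left to
    \<open>gnn\<close>.\<close>
  have diag: "q dvd g i i - 1" if "1 \<le> i" "i < n - 1" for i
    using step[of "Suc i"] \<tau>_id[of i] that by simp
  have n11: "\<not> q dvd g 1 1" using \<tau>(3)[of 1] \<tau>_id[of 1] n by simp
  have o: "q dvd g 1 b" if "b < n" "b \<noteq> 1" for b using off'[of 1 b] that n by simp
  have o0: "q dvd g 1 0" using o[of 0] n by simp
  have rel1: "q dvd g 1 i * g 0 (i - 1) - g 1 (i - 1) * g 0 i - g 1 i" if "1 \<le> i" "i < n" for i
    using rel[of 1] n that by (simp add: pc_rel_def)
  have "q dvd g 1 1 * g 0 0 - g 1 0 * g 0 1 - g 1 1"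
    using rel1[of 1] n by simp
  from dvd_add[OF this dvd_mult2[OF o0, of "g 0 1"]] have "q dvd g 1 1 * (g 0 0 - 1)"
    by (simp add: algebra_simps)
  then have g00: "q dvd g 0 0 - 1" using n11 q by (simp add: prime_dvd_mult_iff)
  \<comment> \<open>The coordinate (b, 1) of the relation for generator 1 is used. Depending on
    whether b is 2, n - 1 or neither, its power term is \<open>g 1 b\<close>, \<open>g 1 0\<close>
    or absent, hence zero modulo \<open>q\<close> in every case.\<close>
  have g0: "q dvd g 0 b" if b: "2 \<le> b" "b < n" for b
  proof -
    have ob: "q dvd g 1 b" using o[of b] b by simp
    have "q dvd g 1 b * g 0 1 - g 1 1 * g 0 b"
    proof -
      consider "b = 2" | "b = n - 1" | "3 \<le> b" "b \<noteq> n - 1" using b by linarith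
      then show ?thesis
      proof cases
        case 1
        then have "q dvd g 1 b * g 0 1 - g 1 1 * g 0 b - g 1 b"
          using rel1[of b] b by simp
        then show ?thesis by (rule zdvd_zdiffD[OF _ ob])
      next
        case 2
        have "q dvd g 1 (n - 1) * g 0 1 - g 1 1 * g 0 (n - 1) - g 1 0"
          using rel[of 1] n by (simp add: pc_rel_def)
        then show ?thesis unfolding 2 by (rule zdvd_zdiffD[OF _ o0])
      next
        case 3
        then show ?thesis using rel[of 1] n b by (simp add: pc_rel_def)
      qed
    qed
    from dvd_diff[OF dvd_mult2[OF ob, of "g 0 1"] this] have "q dvd g 1 1 * g 0 b" by simp
    then show ?thesis using n11 q by (simp add: prime_dvd_mult_iff)
  qed
  have rel0_adj: "q dvd g (n - 1) i * g 1 (i - 1) - g (n - 1) (i - 1) * g 1 i - g 0 i" if "1 \<le> i" "i < n" for i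
    using rel0 that by (simp add: pc_rel_def)
  \<comment> \<open>This is the coordinate (1, 0) of the relation for generator 0;
    \<open>g (n - 1)\<close> vanishes at 0 and 1 because n - 1 exceeds 1.\<close>
  have "q dvd g (n - 1) 1 * g 1 0 - g (n - 1) 0 * g 1 1 - g 0 1"
    using rel0_adj[of 1] n by simp
  moreover have "q dvd g (n - 1) 1 * g 1 0 - g (n - 1) 0 * g 1 1"
    using off'[of "n - 1" 1] off'[of "n - 1" 0] n by auto
  ultimately have g01: "q dvd g 0 1"
    using dvd_diff[of q "g (n - 1) 1 * g 1 0 - g (n - 1) 0 * g 1 1" "g (n - 1) 1 * g 1 0 - g (n - 1) 0 * g 1 1 - g 0 1"] by simp
  \<comment> \<open>At the exceptional pair (n - 1, 1) the relation for generator 0 equates the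
    product of two diagonal entries with \<open>g 0 0\<close>.\<close>
  have gnn: "q dvd g (n - 1) (n - 1) - 1"
  proof -
    have r: "q dvd g (n - 1) (n - 1) * g 1 1 - g (n - 1) 1 * g 1 (n - 1) - g 0 0"
      using rel0 by (simp add: pc_rel_def)
    have g11: "q dvd g 1 1 - 1" using diag[of 1] n by simp
    have g1n: "q dvd g 1 (n - 1)" using o[of "n - 1"] n by simp
    have "g (n - 1) (n - 1) - 1 =
        (g (n - 1) (n - 1) * g 1 1 - g (n - 1) 1 * g 1 (n - 1) - g 0 0) + (g 0 0 - 1)
        - g (n - 1) (n - 1) * (g 1 1 - 1) + g (n - 1) 1 * g 1 (n - 1)" by (simp add: algebra_simps)
    also have "q dvd \<dots>"
      by (intro dvd_add dvd_diff dvd_mult g11 g1n g00 r)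
    finally show ?thesis .
  qed
  have "q dvd g i i - 1"
  proof -
    consider "i = 0" | "i = n - 1" | "1 \<le> i" "i < n - 1" using i by linarith
    then show ?thesis using g00 gnn diag by cases auto
  qed
  moreover have "q dvd g i j" if ne: "i \<noteq> j"
  proof -
    consider "1 \<le> i" | "i = 0" "j = 1" | "i = 0" "2 \<le> j" using ne by arith
    then show ?thesis
    proof cases
      case 1 then show ?thesis using off' i j ne by blast
    next
      case 2 then show ?thesis using g01 by simp
    next
      case 3 then show ?thesis using g0 j by simp
    qed
  qed
  ultimately show ?thesis
    by (cases "i = j") (auto simp: cong_iff_dvd_diff)
qed

section \<open>The rigid group\<close>

locale rigid_p_group =
  fixes p n :: nat
  assumes prime_p: "Factorial_Ring.prime p" and odd_p: "odd p" and n4: "4 \<le> n"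
begin

abbreviation q :: int where "q \<equiv> int p"

text \<open>The pair (a, b) labels the commutator of the generators a and b, in this order.\<close>

definition pairs :: "(nat \<times> nat) set" where
  "pairs = {(a, b). b < a \<and> a < n}"

text \<open>The label of the commutator that equals the p-th power of the i-th generator.\<close>

definition edge :: "nat \<Rightarrow> nat \<times> nat" where
  "edge i = (if i = 0 then (n - 1, 1) else (i, i - 1))"

definition edges :: "(nat \<times> nat) set" where
  "edges = edge ` {..<n}"

text \<open>The exponent of the i-th generator, meaningful modulo \<open>q\<close> only.\<close>

definition hat :: "(nat \<times> nat \<Rightarrow> int) \<Rightarrow> nat \<Rightarrow> int" where
  "hat x i = x (edge i)"

text \<open>The bilinear part of the product. Its antisymmetrisation is the commutator map: at (a,
  b) it is the minor of the exponents at a and b.\<close>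

definition bil :: "(nat \<times> nat \<Rightarrow> int) \<Rightarrow> (nat \<times> nat \<Rightarrow> int) \<Rightarrow> nat \<times> nat \<Rightarrow> int" where
  "bil x y e = hat x (fst e) * hat y (snd e)"

text \<open>Least residues and restriction to \<open>pairs\<close> give every element a unique
  representative, so that equality in \<open>G\<close> is coordinatewise congruence.\<close>

definition red :: "(nat \<times> nat \<Rightarrow> int) \<Rightarrow> nat \<times> nat \<Rightarrow> int" where
  "red f = (\<lambda>e\<in>pairs. f e mod q\<^sup>2)"

text \<open>The coordinate at \<open>edge i\<close> ranges over the integers modulo \<open>p\<^sup>2\<close>: its residue modulo \<open>p\<close> is the
  exponent of the \<open>i\<close>-th generator, and its multiples of \<open>p\<close> are the exponents of the commutator equal
  to the \<open>p\<close>-th power of that generator. The other coordinates range over the multiples of \<open>p\<close>.\<close>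

definition G :: "(nat \<times> nat \<Rightarrow> int) monoid" where
  "G = \<lparr>carrier = {x \<in> extensional pairs. \<forall>e\<in>pairs. 0 \<le> x e \<and> x e < q\<^sup>2 \<and> (e \<notin> edges \<longrightarrow> q dvd x e)},
        monoid.mult = \<lambda>x y. red (\<lambda>e. x e + y e + q * bil x y e),
        one = red (\<lambda>_. 0)\<rparr>"

text \<open>Off \<open>edges\<close> the divisibility holds in all of \<open>G\<close>, so this is
  the common kernel of the generator exponents modulo \<open>q\<close>. Commutators and p-th powers
  fall into it.\<close>

definition W :: "(nat \<times> nat \<Rightarrow> int) set" where
  "W = {x \<in> carrier G. \<forall>e\<in>pairs. q dvd x e}"

section \<open>Arithmetic of the coordinates\<close>

lemma q_pos: "0 < q" using prime_p by (simp add: prime_gt_0_nat)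

lemma prime_q: "Factorial_Ring.prime q" using prime_p by simp

lemma q_not_dvd_1: "\<not> q dvd 1" using prime_q by (metis not_prime_unit)

text \<open>The exponents count modulo \<open>q\<close>, while \<open>bil\<close> enters the product
  multiplied by \<open>q\<close>; this links the two moduli.\<close>

lemma q_cong: "[q * a = q * b] (mod q\<^sup>2) \<longleftrightarrow> [a = b] (mod q)"
proof -
  have "q\<^sup>2 dvd q * a - q * b \<longleftrightarrow> q * q dvd q * (a - b)"
    by (simp add: power2_eq_square algebra_simps)
  then show ?thesis using q_pos by (simp add: cong_iff_dvd_diff)
qed

lemma cong_q_square: "[a = b] (mod q\<^sup>2) \<Longrightarrow> [a = b] (mod q)"
  by (rule cong_dvd_modulus) (auto simp: power2_eq_square)

lemma edge_in_pairs: "i < n \<Longrightarrow> edge i \<in> pairs"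
  using n4 by (auto simp: edge_def pairs_def)

lemma edges_subset: "edges \<subseteq> pairs"
  using edge_in_pairs by (auto simp: edges_def)

text \<open>For n = 3 the pair (n - 1, 1) would coincide with \<open>edge 2\<close>; the bound on
  \<open>n\<close> excludes this.\<close>

lemma inj_edge: "inj_on edge {..<n}"
  using n4 by (auto simp: edge_def inj_on_def split: if_splits)

lemma pairs_lt: "e \<in> pairs \<Longrightarrow> fst e < n" "e \<in> pairs \<Longrightarrow> snd e < n"
  by (auto simp: pairs_def)

lemma finite_pairs: "finite pairs"
  by (rule finite_subset[of _ "{..<n} \<times> {..<n}"]) (auto simp: pairs_def)

lemma red_cong: "e \<in> pairs \<Longrightarrow> [red f e = f e] (mod q\<^sup>2)"
  by (simp add: red_def cong_def)

lemma red_closed: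
  assumes "\<And>e. e \<in> pairs \<Longrightarrow> e \<notin> edges \<Longrightarrow> q dvd f e"
  shows "red f \<in> carrier G"
  using assms q_pos by (auto simp: G_def red_def dvd_mod_iff)

lemma dvd_coord: "x \<in> carrier G \<Longrightarrow> e \<in> pairs \<Longrightarrow> e \<notin> edges \<Longrightarrow> q dvd x e"
  by (simp add: G_def)

lemma carrier_eq_iff:
  assumes "x \<in> carrier G" "y \<in> carrier G"
  shows "x = y \<longleftrightarrow> (\<forall>e\<in>pairs. [x e = y e] (mod q\<^sup>2))"
proof
  assume "\<forall>e\<in>pairs. [x e = y e] (mod q\<^sup>2)"
  then have "x e = y e" if "e \<in> pairs" for e
    using assms that by (auto simp: G_def intro!: cong_less_imp_eq_int)
  then show "x = y"
    using assms by (intro extensionalityI[of x pairs y]) (auto simp: G_def)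
qed simp

lemma mult_cong: "e \<in> pairs \<Longrightarrow> [(x \<otimes>\<^bsub>G\<^esub> y) e = x e + y e + q * bil x y e] (mod q\<^sup>2)"
  using red_cong[of e "\<lambda>e. x e + y e + q * bil x y e"] by (simp add: G_def)

lemma hat_mult: "i < n \<Longrightarrow> [hat (x \<otimes>\<^bsub>G\<^esub> y) i = hat x i + hat y i] (mod q)"
proof -
  assume "i < n"
  then have "[hat (x \<otimes>\<^bsub>G\<^esub> y) i = hat x i + hat y i + q * bil x y (edge i)] (mod q)"
    unfolding hat_def by (intro cong_q_square mult_cong edge_in_pairs)
  then show ?thesis by (simp add: cong_def)
qed

lemma bil_cong:
  assumes "\<And>i. i < n \<Longrightarrow> [hat x i = hat x' i] (mod q)" "\<And>i. i < n \<Longrightarrow> [hat y i = hat y' i] (mod q)" "e \<in> pairs"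
  shows "[bil x y e = bil x' y' e] (mod q)"
  using assms by (auto simp: bil_def pairs_lt intro!: cong_mult)

lemma bil_mult_left: "e \<in> pairs \<Longrightarrow> [bil (x \<otimes>\<^bsub>G\<^esub> y) z e = bil x z e + bil y z e] (mod q)"
  using cong_mult[OF hat_mult[of "fst e" x y] cong_refl[of "hat z (snd e)"]] pairs_lt[of e]
  by (simp add: bil_def distrib_right)

lemma bil_mult_right: "e \<in> pairs \<Longrightarrow> [bil x (y \<otimes>\<^bsub>G\<^esub> z) e = bil x y e + bil x z e] (mod q)"
  using cong_mult[OF cong_refl[of "hat x (fst e)"] hat_mult[of "snd e" y z]] pairs_lt[of e]
  by (simp add: bil_def distrib_left)

section \<open>Group laws\<close>

lemma mult_closed:
  assumes "x \<in> carrier G" "y \<in> carrier G"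
  shows "x \<otimes>\<^bsub>G\<^esub> y \<in> carrier G"
proof -
  have "red (\<lambda>e. x e + y e + q * bil x y e) \<in> carrier G"
    using assms by (intro red_closed dvd_add dvd_triv_left dvd_coord)
  then show ?thesis by (simp add: G_def)
qed

lemma one_closed: "\<one>\<^bsub>G\<^esub> \<in> carrier G"
  using red_closed[of "\<lambda>_. 0"] by (simp add: G_def)

lemma one_coord: "e \<in> pairs \<Longrightarrow> \<one>\<^bsub>G\<^esub> e = 0"
  by (simp add: G_def red_def)

lemma hat_one: "i < n \<Longrightarrow> hat \<one>\<^bsub>G\<^esub> i = 0"
  by (simp add: hat_def one_coord edge_in_pairs)

text \<open>Biadditivity of \<open>bil\<close> modulo \<open>q\<close> makes \<open>q * bil\<close>
  a 2-cocycle modulo \<open>q\<^sup>2\<close>.\<close>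

lemma mult_assoc:
  assumes "x \<in> carrier G" "y \<in> carrier G" "z \<in> carrier G"
  shows "x \<otimes>\<^bsub>G\<^esub> y \<otimes>\<^bsub>G\<^esub> z = x \<otimes>\<^bsub>G\<^esub> (y \<otimes>\<^bsub>G\<^esub> z)"
proof -
  have "[(x \<otimes>\<^bsub>G\<^esub> y \<otimes>\<^bsub>G\<^esub> z) e = (x \<otimes>\<^bsub>G\<^esub> (y \<otimes>\<^bsub>G\<^esub> z)) e] (mod q\<^sup>2)" if e: "e \<in> pairs" for e
  proof -
    have "[(x \<otimes>\<^bsub>G\<^esub> y) e + z e + q * bil (x \<otimes>\<^bsub>G\<^esub> y) z e =
        (x e + y e + q * bil x y e) + z e + q * (bil x z e + bil y z e)] (mod q\<^sup>2)"
      by (intro cong_add mult_cong e cong_refl q_cong[THEN iffD2] bil_mult_left)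
    moreover have "[x e + (y \<otimes>\<^bsub>G\<^esub> z) e + q * bil x (y \<otimes>\<^bsub>G\<^esub> z) e =
        x e + (y e + z e + q * bil y z e) + q * (bil x y e + bil x z e)] (mod q\<^sup>2)"
      by (intro cong_add mult_cong e cong_refl q_cong[THEN iffD2] bil_mult_right)
    moreover have "(x e + y e + q * bil x y e) + z e + q * (bil x z e + bil y z e) =
        x e + (y e + z e + q * bil y z e) + q * (bil x y e + bil x z e)"
      by (simp add: algebra_simps)
    ultimately show ?thesis
      using mult_cong[OF e, of "x \<otimes>\<^bsub>G\<^esub> y" z] mult_cong[OF e, of x "y \<otimes>\<^bsub>G\<^esub> z"]
      by (simp add: cong_def)
  qed
  then show ?thesis using assms by (simp add: carrier_eq_iff mult_closed)
qed

lemma one_mult: "x \<in> carrier G \<Longrightarrow> \<one>\<^bsub>G\<^esub> \<otimes>\<^bsub>G\<^esub> x = x"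
  using mult_cong[of _ "\<one>\<^bsub>G\<^esub>" x]
  by (auto simp: carrier_eq_iff mult_closed one_closed one_coord bil_def hat_one pairs_lt)

lemma left_inverse:
  assumes x: "x \<in> carrier G"
  shows "\<exists>y\<in>carrier G. y \<otimes>\<^bsub>G\<^esub> x = \<one>\<^bsub>G\<^esub>"
proof
  \<comment> \<open>The summand \<open>q * bil x x e\<close> cancels the bilinear term of the
    product, in which the exponents of x appear once with negative sign.\<close>
  let ?y = "red (\<lambda>e. - x e + q * bil x x e)"
  show y: "?y \<in> carrier G"
    using x by (intro red_closed) (simp add: dvd_coord)
  have hat: "[hat ?y i = - hat x i] (mod q)" if "i < n" for i
  proof -
    have "[?y (edge i) = - x (edge i) + q * bil x x (edge i)] (mod q)"
      by (intro cong_q_square red_cong edge_in_pairs that)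
    moreover have "[- x (edge i) + q * bil x x (edge i) = - x (edge i)] (mod q)"
      by (simp add: cong_iff_dvd_diff)
    ultimately show ?thesis unfolding hat_def by (rule cong_trans)
  qed
  have "[(?y \<otimes>\<^bsub>G\<^esub> x) e = \<one>\<^bsub>G\<^esub> e] (mod q\<^sup>2)" if e: "e \<in> pairs" for e
  proof -
    have "[bil ?y x e = - bil x x e] (mod q)"
      using cong_mult[OF hat[of "fst e"] cong_refl[of "hat x (snd e)"]] pairs_lt[OF e] by (simp add: bil_def)
    then have "[?y e + x e + q * bil ?y x e = (- x e + q * bil x x e) + x e + q * (- bil x x e)] (mod q\<^sup>2)"
      by (intro cong_add cong_refl red_cong e q_cong[THEN iffD2])
    from cong_trans[OF mult_cong[OF e, of ?y x] this] show ?thesis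
      by (simp add: one_coord e)
  qed
  then show "?y \<otimes>\<^bsub>G\<^esub> x = \<one>\<^bsub>G\<^esub>"
    using x y by (simp add: carrier_eq_iff mult_closed one_closed)
qed

sublocale group G
  by (rule groupI) (auto simp: mult_closed one_closed mult_assoc one_mult left_inverse)

section \<open>Finiteness and order\<close>

lemma finite_carrier: "finite (carrier G)"
proof (rule finite_subset)
  show "carrier G \<subseteq> (\<Pi>\<^sub>E e\<in>pairs. {0..<q\<^sup>2})" by (auto simp: G_def PiE_def)
  show "finite (\<Pi>\<^sub>E e\<in>pairs. {0..<q\<^sup>2})" by (intro finite_PiE finite_pairs) auto
qed

lemma card_pairs: "card pairs = n choose 2"
proof -
  have "pairs = (SIGMA a:{..<n}. {..<a})" by (auto simp: pairs_def)
  then have "card pairs = (\<Sum>a<n. a)" by simp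
  also have "\<dots> = n choose 2" by (induction n) (auto simp: numeral_2_eq_2)
  finally show ?thesis .
qed

text \<open>There are n coordinates at edges with \<open>p\<^sup>2\<close> values each, and every
  other pair contributes p values.\<close>

lemma order_G: "order G = p ^ (n + (n choose 2))"
proof -
  have p0: "0 < p" using q_pos by simp
  have multiples: "{k. 0 \<le> k \<and> k < q\<^sup>2 \<and> q dvd k} = (*) q ` {0..<q}"
  proof (rule Set.set_eqI, rule iffI)
    fix k assume "k \<in> {k. 0 \<le> k \<and> k < q\<^sup>2 \<and> q dvd k}"
    then obtain c where "k = q * c" "0 \<le> q * c" "q * c < q * q" by (auto simp: power2_eq_square)
    then show "k \<in> (*) q ` {0..<q}" using q_pos by (auto simp: zero_le_mult_iff)
  qed (use q_pos in \<open>auto simp: power2_eq_square\<close>)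
  have "carrier G = (\<Pi>\<^sub>E e\<in>pairs. if e \<in> edges then {0..<q\<^sup>2} else {k. 0 \<le> k \<and> k < q\<^sup>2 \<and> q dvd k})"
    by (auto simp: G_def PiE_def Pi_def split: if_splits)
  then have "order G = (\<Prod>e\<in>pairs. card (if e \<in> edges then {0..<q\<^sup>2} else {k. 0 \<le> k \<and> k < q\<^sup>2 \<and> q dvd k}))"
    by (simp add: order_def card_PiE finite_pairs)
  also have "\<dots> = (\<Prod>e\<in>pairs. if e \<in> edges then p\<^sup>2 else p)"
    using p0 by (intro prod.cong refl) (auto simp: multiples card_image inj_on_def nat_power_eq)
  also have "\<dots> = (p\<^sup>2) ^ card edges * p ^ card (pairs - edges)"
    using edges_subset finite_pairs by (simp add: prod.If_cases Int_absorb1 Diff_eq)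
  also have "card edges = n"
    unfolding edges_def using inj_edge by (simp add: card_image)
  also have "card (pairs - edges) = (n choose 2) - n"
    using edges_subset finite_pairs \<open>card edges = n\<close> by (simp add: card_Diff_subset finite_subset card_pairs)
  also have "(p\<^sup>2) ^ n * p ^ ((n choose 2) - n) = p ^ (2 * n + ((n choose 2) - n))"
    by (simp add: power_mult power_add)
  \<comment> \<open>The truncated subtraction is harmless: the n edges are among the pairs.\<close>
  also have "2 * n + ((n choose 2) - n) = n + (n choose 2)"
    using card_mono[OF finite_pairs edges_subset] \<open>card edges = n\<close> by (simp add: card_pairs)
  finally show ?thesis .
qed

section \<open>Powers and commutators\<close>

lemma pow_cong:
  assumes x: "x \<in> carrier G" and e: "e \<in> pairs"
  shows "[(x [^]\<^bsub>G\<^esub> (k::nat)) e = int k * x e + q * (int (k choose 2) * bil x x e)] (mod q\<^sup>2)"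
  using e
proof (induction k arbitrary: e)
  case 0 then show ?case by (simp add: one_coord numeral_2_eq_2)
next
  case (Suc k)
  have "[hat (x [^]\<^bsub>G\<^esub> k) i = int k * hat x i] (mod q)" if "i < n" for i
    using cong_q_square[OF Suc.IH[OF edge_in_pairs[OF that]]]
    by (simp add: hat_def cong_def)
  \<comment> \<open>One further factor x adds k copies of \<open>bil x x\<close>; summed over the
    smaller exponents they give the binomial coefficient.\<close>
  from cong_mult[OF this cong_refl[of "hat x (snd e)"], of "fst e"]
  have b: "[bil (x [^]\<^bsub>G\<^esub> k) x e = int k * bil x x e] (mod q)"
    using Suc.prems by (simp add: bil_def pairs_lt mult.assoc)
  have "[(x [^]\<^bsub>G\<^esub> k) e + x e + q * bil (x [^]\<^bsub>G\<^esub> k) x e =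
      int k * x e + q * (int (k choose 2) * bil x x e) + x e + q * (int k * bil x x e)] (mod q\<^sup>2)"
    by (intro cong_add cong_refl Suc.IH Suc.prems q_cong[THEN iffD2] b)
  with mult_cong[OF Suc.prems, of "x [^]\<^bsub>G\<^esub> k" x]
  have "[(x [^]\<^bsub>G\<^esub> Suc k) e =
      int k * x e + q * (int (k choose 2) * bil x x e) + x e + q * (int k * bil x x e)] (mod q\<^sup>2)"
    by (auto intro: cong_trans)
  also have "int k * x e + q * (int (k choose 2) * bil x x e) + x e + q * (int k * bil x x e) =
      int (Suc k) * x e + q * (int (Suc k choose 2) * bil x x e)"
    by (simp add: numeral_2_eq_2 algebra_simps)
  finally show ?case .
qed

text \<open>Oddness of p enters here: p divides \<open>p choose 2\<close>, so the bilinear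
  correction vanishes modulo \<open>q\<^sup>2\<close>.\<close>

lemma pow_p_cong:
  assumes x: "x \<in> carrier G" and e: "e \<in> pairs"
  shows "[(x [^]\<^bsub>G\<^esub> p) e = q * x e] (mod q\<^sup>2)"
proof -
  have "2 < p" using prime_p odd_p prime_gt_1_nat[OF prime_p] by (cases "p = 2") auto
  then have "p dvd p choose 2" using prime_p by (intro dvd_choose_prime) auto
  then have "q dvd int (p choose 2)" by simp
  then have "[int (p choose 2) * bil x x e = 0] (mod q)" by (simp add: cong_0_iff)
  then have "[q * x e + q * (int (p choose 2) * bil x x e) = q * x e + q * 0] (mod q\<^sup>2)"
    by (intro cong_add cong_refl q_cong[THEN iffD2])
  from cong_trans[OF pow_cong[OF assms, of p] this] show ?thesis by simp
qed

lemma q_dvd_cong: "[a = q * b] (mod q\<^sup>2) \<Longrightarrow> q dvd a"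
  using cong_q_square[of a "q * b"] by (simp add: cong_dvd_iff)

lemma pow_p_in_W: "x \<in> carrier G \<Longrightarrow> x [^]\<^bsub>G\<^esub> p \<in> W"
  unfolding W_def using pow_p_cong q_dvd_cong by blast

lemma W_closed: "w \<in> W \<Longrightarrow> w \<in> carrier G" by (simp add: W_def)

lemma one_in_W: "\<one>\<^bsub>G\<^esub> \<in> W" by (simp add: W_def one_closed one_coord)

lemma hat_W: "w \<in> W \<Longrightarrow> i < n \<Longrightarrow> [hat w i = 0] (mod q)"
  by (simp add: W_def hat_def edge_in_pairs cong_0_iff)

lemma W_mult_cong:
  assumes w: "w \<in> W" and e: "e \<in> pairs"
  shows "[(w \<otimes>\<^bsub>G\<^esub> x) e = w e + x e] (mod q\<^sup>2)"
proof -
  have "[bil w x e = 0] (mod q)"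
    using cong_mult[OF hat_W[OF w, of "fst e"] cong_refl[of "hat x (snd e)"]] pairs_lt[OF e] by (simp add: bil_def)
  then have "[w e + x e + q * bil w x e = w e + x e + q * 0] (mod q\<^sup>2)"
    by (intro cong_add cong_refl q_cong[THEN iffD2])
  from cong_trans[OF mult_cong[OF e, of w x] this] show ?thesis by simp
qed

text \<open>Both products have the same additive part, so only the antisymmetrised bilinear term
  remains. In particular commutators depend only on exponents modulo \<open>q\<close>.\<close>

lemma commutator_iff:
  assumes "x \<in> carrier G" "y \<in> carrier G" "w \<in> W"
  shows "x \<otimes>\<^bsub>G\<^esub> y = w \<otimes>\<^bsub>G\<^esub> (y \<otimes>\<^bsub>G\<^esub> x) \<longleftrightarrow> (\<forall>e\<in>pairs. [w e = q * (bil x y e - bil y x e)] (mod q\<^sup>2))"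
proof -
  have cong_iff: "[a = b] (mod q\<^sup>2) \<longleftrightarrow> [a' = b'] (mod q\<^sup>2)" if "[a = a'] (mod q\<^sup>2)" "[b = b'] (mod q\<^sup>2)" for a b a' b'
    using that by (simp add: cong_def)
  have "[(x \<otimes>\<^bsub>G\<^esub> y) e = (w \<otimes>\<^bsub>G\<^esub> (y \<otimes>\<^bsub>G\<^esub> x)) e] (mod q\<^sup>2) \<longleftrightarrow> [w e = q * (bil x y e - bil y x e)] (mod q\<^sup>2)"
    if e: "e \<in> pairs" for e
  proof -
    have "[w e + (y \<otimes>\<^bsub>G\<^esub> x) e = w e + (y e + x e + q * bil y x e)] (mod q\<^sup>2)"
      by (intro cong_add cong_refl mult_cong e)
    with W_mult_cong[OF assms(3) e, of "y \<otimes>\<^bsub>G\<^esub> x"]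
    have "[(w \<otimes>\<^bsub>G\<^esub> (y \<otimes>\<^bsub>G\<^esub> x)) e = w e + (y e + x e + q * bil y x e)] (mod q\<^sup>2)"
      by (rule cong_trans)
    then have "[(x \<otimes>\<^bsub>G\<^esub> y) e = (w \<otimes>\<^bsub>G\<^esub> (y \<otimes>\<^bsub>G\<^esub> x)) e] (mod q\<^sup>2) \<longleftrightarrow>
        [x e + y e + q * bil x y e = w e + (y e + x e + q * bil y x e)] (mod q\<^sup>2)"
      by (intro cong_iff mult_cong e)
    also have "\<dots> \<longleftrightarrow> [w e = q * (bil x y e - bil y x e)] (mod q\<^sup>2)"
    proof -
      have "x e + y e + q * bil x y e - (w e + (y e + x e + q * bil y x e)) =
          - (w e - q * (bil x y e - bil y x e))" by (simp add: algebra_simps)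
      then show ?thesis unfolding cong_iff_dvd_diff by (simp only: dvd_minus_iff)
    qed
    finally show ?thesis .
  qed
  then show ?thesis
    using assms by (subst carrier_eq_iff) (auto simp: mult_closed W_closed intro!: ball_cong)
qed

text \<open>This translates the group relation [x, y] = z^p into arithmetic. Both sides lie in
  \<open>W\<close>, and a factor \<open>q\<close> cancels. At \<open>edge i\<close> the coordinate
  of z is its exponent \<open>hat z i\<close>; off the edges it is a multiple of \<open>q\<close>
  and drops out.\<close>

lemma power_commutator_iff:
  assumes x: "x \<in> carrier G" and y: "y \<in> carrier G" and z: "z \<in> carrier G"
  shows "x \<otimes>\<^bsub>G\<^esub> y = z [^]\<^bsub>G\<^esub> p \<otimes>\<^bsub>G\<^esub> (y \<otimes>\<^bsub>G\<^esub> x) \<longleftrightarrow> pc_rel n q (hat x) (hat y) (hat z)"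
proof -
  have "x \<otimes>\<^bsub>G\<^esub> y = z [^]\<^bsub>G\<^esub> p \<otimes>\<^bsub>G\<^esub> (y \<otimes>\<^bsub>G\<^esub> x) \<longleftrightarrow>
      (\<forall>e\<in>pairs. [(z [^]\<^bsub>G\<^esub> p) e = q * (bil x y e - bil y x e)] (mod q\<^sup>2))"
    by (rule commutator_iff[OF x y pow_p_in_W[OF z]])
  also have "\<dots> \<longleftrightarrow> (\<forall>e\<in>pairs. [q * z e = q * (bil x y e - bil y x e)] (mod q\<^sup>2))"
  proof (intro ball_cong refl)
    fix e assume "e \<in> pairs"
    from pow_p_cong[OF z this] show "[(z [^]\<^bsub>G\<^esub> p) e = q * (bil x y e - bil y x e)] (mod q\<^sup>2) \<longleftrightarrow>
        [q * z e = q * (bil x y e - bil y x e)] (mod q\<^sup>2)"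
      by (simp add: cong_def)
  qed
  also have "\<dots> \<longleftrightarrow> (\<forall>e\<in>pairs. q dvd bil x y e - bil y x e - z e)"
    by (intro ball_cong refl) (simp only: q_cong cong_sym_eq[of "z _"], simp add: cong_iff_dvd_diff)
  also have "\<dots> \<longleftrightarrow> pc_rel n q (hat x) (hat y) (hat z)"
  proof
    assume *: "\<forall>e\<in>pairs. q dvd bil x y e - bil y x e - z e"
    show "pc_rel n q (hat x) (hat y) (hat z)"
      unfolding pc_rel_def
    proof (intro conjI allI impI)
      fix i assume i: "1 \<le> i" "i < n"
      then show "q dvd hat x i * hat y (i - 1) - hat x (i - 1) * hat y i - hat z i"
        using *[rule_format, OF edge_in_pairs[OF i(2)]] by (simp add: bil_def hat_def[of z] edge_def mult.commute)
    next
      show "q dvd hat x (n - 1) * hat y 1 - hat x 1 * hat y (n - 1) - hat z 0"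
        using *[rule_format, OF edge_in_pairs[of 0]] n4 by (simp add: bil_def hat_def[of z] edge_def mult.commute)
    next
      fix a b assume ab: "b + 2 \<le> a" "a < n" "(a, b) \<noteq> (n - 1, 1)"
      then have "(a, b) \<in> pairs" "(a, b) \<notin> edges" by (auto simp: pairs_def edges_def edge_def)
      then have "q dvd z (a, b)" "q dvd bil x y (a, b) - bil y x (a, b) - z (a, b)"
        using dvd_coord[OF z] * by auto
      from dvd_add[OF this(2,1)] show "q dvd hat x a * hat y b - hat x b * hat y a"
        by (simp add: bil_def mult.commute)
    qed
  next
    assume rel: "pc_rel n q (hat x) (hat y) (hat z)"
    show "\<forall>e\<in>pairs. q dvd bil x y e - bil y x e - z e"
    proof
      fix e assume e: "e \<in> pairs"
      obtain a b where ab: "e = (a, b)" "b < a" "a < n" using e by (auto simp: pairs_def)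
      consider "b = a - 1" | "a = n - 1" "b = 1" | "b + 2 \<le> a" "(a, b) \<noteq> (n - 1, 1)"
        using ab by (cases "b + 2 \<le> a") auto
      then show "q dvd bil x y e - bil y x e - z e"
      proof cases
        case 1
        then have "z e = hat z a" using ab by (simp add: hat_def edge_def)
        moreover have "q dvd hat x a * hat y (a - 1) - hat x (a - 1) * hat y a - hat z a"
          using rel ab by (simp add: pc_rel_def)
        ultimately show ?thesis using 1 ab by (simp add: bil_def mult.commute)
      next
        case 2
        then have "z e = hat z 0" using ab by (simp add: hat_def edge_def)
        moreover have "q dvd hat x (n - 1) * hat y 1 - hat x 1 * hat y (n - 1) - hat z 0"
          using rel by (simp add: pc_rel_def)
        ultimately show ?thesis using 2 ab by (simp add: bil_def mult.commute)
      next
        case 3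
        then have "e \<notin> edges" using ab by (auto simp: edges_def edge_def)
        then have "q dvd z e" using dvd_coord[OF z e] by simp
        moreover have "q dvd hat x a * hat y b - hat x b * hat y a"
          using rel ab 3 by (auto simp: pc_rel_def)
        ultimately show ?thesis using ab by (simp add: bil_def mult.commute dvd_diff)
      qed
    qed
  qed
  finally show ?thesis .
qed

section \<open>Generators of the group and of its central subgroup\<close>

definition gen :: "nat \<Rightarrow> nat \<times> nat \<Rightarrow> int" where
  "gen i = red (\<lambda>e. of_bool (e = edge i))"

lemma gen_closed: "i < n \<Longrightarrow> gen i \<in> carrier G"
  unfolding gen_def by (rule red_closed) (auto simp: edges_def)

lemma hat_gen:
  assumes "i < n" "j < n"
  shows "hat (gen i) j = of_bool (i = j)"
proof -
  have "1 < q\<^sup>2" using prime_gt_1_nat[OF prime_p] by (simp add: one_less_power)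
  moreover have "edge j = edge i \<longleftrightarrow> i = j" using inj_edge assms by (auto simp: inj_on_def)
  ultimately show ?thesis using assms by (simp add: hat_def gen_def red_def edge_in_pairs)
qed

text \<open>For e = (a, b) in \<open>pairs\<close> this is the commutator of \<open>gen a\<close>
  and \<open>gen b\<close>; these elements generate \<open>W\<close>.\<close>

definition unit_W :: "nat \<times> nat \<Rightarrow> nat \<times> nat \<Rightarrow> int" where
  "unit_W e = red (\<lambda>e'. q * of_bool (e' = e))"

lemma unit_W_cong: "e' \<in> pairs \<Longrightarrow> [unit_W e e' = q * of_bool (e' = e)] (mod q\<^sup>2)"
  unfolding unit_W_def by (rule red_cong)

lemma unit_W_in_W: "unit_W e \<in> W"
proof -
  have "unit_W e \<in> carrier G" unfolding unit_W_def by (rule red_closed) simp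
  then show ?thesis unfolding W_def using unit_W_cong[of _ e] q_dvd_cong by blast
qed

lemma commute_iff:
  assumes "x \<in> carrier G" "y \<in> carrier G"
  shows "x \<otimes>\<^bsub>G\<^esub> y = y \<otimes>\<^bsub>G\<^esub> x \<longleftrightarrow> (\<forall>e\<in>pairs. [bil x y e = bil y x e] (mod q))"
proof -
  have "[\<one>\<^bsub>G\<^esub> e = q * (bil x y e - bil y x e)] (mod q\<^sup>2) \<longleftrightarrow> [bil x y e = bil y x e] (mod q)" if "e \<in> pairs" for e
    using q_cong[of 0 "bil x y e - bil y x e"] that
    by (simp add: one_coord cong_iff_dvd_diff dvd_diff_commute)
  then show ?thesis
    using commutator_iff[OF assms one_in_W] assms by (simp add: one_mult)
qed

lemma ex_commutator:
  assumes "x \<in> carrier G" "y \<in> carrier G"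
  shows "\<exists>w\<in>W. x \<otimes>\<^bsub>G\<^esub> y = w \<otimes>\<^bsub>G\<^esub> (y \<otimes>\<^bsub>G\<^esub> x)"
proof
  let ?w = "red (\<lambda>e. q * (bil x y e - bil y x e))"
  show w: "?w \<in> W"
    using red_cong[of _ "\<lambda>e. q * (bil x y e - bil y x e)"] q_dvd_cong by (auto simp: W_def intro!: red_closed)
  show "x \<otimes>\<^bsub>G\<^esub> y = ?w \<otimes>\<^bsub>G\<^esub> (y \<otimes>\<^bsub>G\<^esub> x)"
    using commutator_iff[OF assms w] red_cong by blast
qed

lemma W_central:
  assumes "w \<in> W" "x \<in> carrier G"
  shows "w \<otimes>\<^bsub>G\<^esub> x = x \<otimes>\<^bsub>G\<^esub> w"
proof -
  have "[bil w x e = bil x w e] (mod q)" if e: "e \<in> pairs" for e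
  proof -
    have "q dvd hat w (fst e)" "q dvd hat w (snd e)"
      using hat_W[OF assms(1)] pairs_lt[OF e] by (simp_all add: cong_0_iff)
    then show ?thesis by (simp add: bil_def cong_iff_dvd_diff dvd_diff)
  qed
  then show ?thesis using assms W_closed by (simp add: commute_iff)
qed

lemma gen_not_commute:
  assumes "i < n" "j < n" "i \<noteq> j"
  shows "gen i \<otimes>\<^bsub>G\<^esub> gen j \<noteq> gen j \<otimes>\<^bsub>G\<^esub> gen i"
proof
  assume "gen i \<otimes>\<^bsub>G\<^esub> gen j = gen j \<otimes>\<^bsub>G\<^esub> gen i"
  then have *: "\<forall>e\<in>pairs. [bil (gen i) (gen j) e = bil (gen j) (gen i) e] (mod q)"
    using assms gen_closed by (simp add: commute_iff)
  have "(max i j, min i j) \<in> pairs" using assms by (auto simp: pairs_def)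
  with * have "[bil (gen i) (gen j) (max i j, min i j) = bil (gen j) (gen i) (max i j, min i j)] (mod q)" by blast
  then show False using assms q_not_dvd_1
    by (auto simp: bil_def hat_gen max_def min_def cong_iff_dvd_diff split: if_splits)
qed

subsection \<open>Automorphisms\<close>

lemma aut_closed: "\<alpha> \<in> iso G G \<Longrightarrow> x \<in> carrier G \<Longrightarrow> \<alpha> x \<in> carrier G"
  by (auto simp: iso_def hom_def)

lemma aut_mult: "\<alpha> \<in> iso G G \<Longrightarrow> x \<in> carrier G \<Longrightarrow> y \<in> carrier G \<Longrightarrow> \<alpha> (x \<otimes>\<^bsub>G\<^esub> y) = \<alpha> x \<otimes>\<^bsub>G\<^esub> \<alpha> y"
  by (auto simp: iso_def hom_def)

lemma aut_inj: "\<alpha> \<in> iso G G \<Longrightarrow> x \<in> carrier G \<Longrightarrow> y \<in> carrier G \<Longrightarrow> \<alpha> x = \<alpha> y \<longleftrightarrow> x = y"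
  by (auto simp: iso_def bij_betw_def inj_on_def)

lemma aut_one: "\<alpha> \<in> iso G G \<Longrightarrow> \<alpha> \<one>\<^bsub>G\<^esub> = \<one>\<^bsub>G\<^esub>"
  using hom_one[of \<alpha> G G] group_axioms by (simp add: iso_def)

lemma aut_pow: "\<alpha> \<in> iso G G \<Longrightarrow> x \<in> carrier G \<Longrightarrow> \<alpha> (x [^]\<^bsub>G\<^esub> (k::nat)) = \<alpha> x [^]\<^bsub>G\<^esub> k"
  by (induction k) (simp_all add: aut_mult aut_one)

text \<open>Automorphisms preserve the group relation [x, y] = z^p that \<open>pc_rel\<close>
  encodes.\<close>

lemma aut_pc_rel:
  assumes \<alpha>: "\<alpha> \<in> iso G G" and "x \<in> carrier G" "y \<in> carrier G" "z \<in> carrier G"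
    and "pc_rel n q (hat x) (hat y) (hat z)"
  shows "pc_rel n q (hat (\<alpha> x)) (hat (\<alpha> y)) (hat (\<alpha> z))"
proof -
  have "x \<otimes>\<^bsub>G\<^esub> y = z [^]\<^bsub>G\<^esub> p \<otimes>\<^bsub>G\<^esub> (y \<otimes>\<^bsub>G\<^esub> x)" using assms by (simp add: power_commutator_iff)
  then have "\<alpha> (x \<otimes>\<^bsub>G\<^esub> y) = \<alpha> (z [^]\<^bsub>G\<^esub> p \<otimes>\<^bsub>G\<^esub> (y \<otimes>\<^bsub>G\<^esub> x))" by simp
  then have "\<alpha> x \<otimes>\<^bsub>G\<^esub> \<alpha> y = \<alpha> z [^]\<^bsub>G\<^esub> p \<otimes>\<^bsub>G\<^esub> (\<alpha> y \<otimes>\<^bsub>G\<^esub> \<alpha> x)"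
    using assms by (simp add: aut_mult aut_pow)
  then show ?thesis using assms by (simp add: power_commutator_iff aut_closed)
qed

lemma pc_rel_gen:
  assumes "1 \<le> i" "i < n"
  shows "pc_rel n q (hat (gen i)) (hat (gen (i - 1))) (hat (gen i))"
  unfolding pc_rel_def
proof (intro conjI allI impI)
  fix j assume j: "1 \<le> j" "j < n"
  have "(i - 1 = j - 1) = (i = j)" "\<not> (i = j - 1 \<and> i - 1 = j)" "j - 1 \<noteq> j" using assms j by arith+
  then show "q dvd hat (gen i) j * hat (gen (i - 1)) (j - 1) - hat (gen i) (j - 1) * hat (gen (i - 1)) j - hat (gen i) j"
    using assms j by (simp add: hat_gen of_bool_def)
next
  have "\<not> (i = n - 1 \<and> i - 1 = 1)" "i - 1 \<noteq> n - 1" "i \<noteq> 0" using assms n4 by arith+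
  then show "q dvd hat (gen i) (n - 1) * hat (gen (i - 1)) 1 - hat (gen i) 1 * hat (gen (i - 1)) (n - 1) - hat (gen i) 0"
    using assms n4 by (simp add: hat_gen of_bool_def)
next
  fix a b assume ab: "b + 2 \<le> a" "a < n"
  then have "\<not> (i = a \<and> i - 1 = b)" "\<not> (i = b \<and> i - 1 = a)" using assms by arith+
  then show "q dvd hat (gen i) a * hat (gen (i - 1)) b - hat (gen i) b * hat (gen (i - 1)) a"
    using assms ab by (simp add: hat_gen of_bool_def)
qed

lemma pc_rel_gen_0: "pc_rel n q (hat (gen (n - 1))) (hat (gen 1)) (hat (gen 0))"
  unfolding pc_rel_def
proof (intro conjI allI impI)
  fix j assume j: "1 \<le> j" "j < n"
  then have "\<not> (n - 1 = j \<and> 1 = j - 1)" "\<not> (n - 1 = j - 1 \<and> 1 = j)" "j \<noteq> 0" using n4 by arith+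
  then show "q dvd hat (gen (n - 1)) j * hat (gen 1) (j - 1) - hat (gen (n - 1)) (j - 1) * hat (gen 1) j - hat (gen 0) j"
    using j n4 by (simp add: hat_gen of_bool_def)
next
  show "q dvd hat (gen (n - 1)) (n - 1) * hat (gen 1) 1 - hat (gen (n - 1)) 1 * hat (gen 1) (n - 1) - hat (gen 0) 0"
    using n4 by (auto simp: hat_gen of_bool_def)
next
  fix a b assume ab: "b + 2 \<le> a" "a < n" "(a, b) \<noteq> (n - 1, 1)"
  then have "\<not> (n - 1 = a \<and> 1 = b)" "\<not> (n - 1 = b \<and> 1 = a)" by auto
  then show "q dvd hat (gen (n - 1)) a * hat (gen 1) b - hat (gen (n - 1)) b * hat (gen 1) a"
    using ab n4 by (auto simp: hat_gen of_bool_def)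
qed

text \<open>The images of the generators satisfy the same power relations, so rigidity applies once
  no image has all its exponents zero.\<close>

lemma aut_gen:
  assumes \<alpha>: "\<alpha> \<in> iso G G" and "i < n" "j < n"
  shows "[hat (\<alpha> (gen i)) j = of_bool (i = j)] (mod q)"
proof (rule pc_rel_rigid[OF prime_q n4 _ _ _ \<open>i < n\<close> \<open>j < n\<close>])
  fix i assume i: "i < n"
  show "\<exists>j<n. \<not> q dvd hat (\<alpha> (gen i)) j"
  \<comment> \<open>An image with zero exponents would commute with the images of all generators,
    whereas \<open>gen i\<close> fails to commute with any other generator.\<close>
  proof (rule ccontr)
    assume "\<not> (\<exists>j<n. \<not> q dvd hat (\<alpha> (gen i)) j)"
    then have 0: "q dvd hat (\<alpha> (gen i)) j" if "j < n" for j using that by blast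
    obtain j where j: "j < n" "i \<noteq> j"
      using n4 that[of 1] that[of 0] by (cases "i = 0") auto
    have c: "\<alpha> (gen i) \<in> carrier G" "\<alpha> (gen j) \<in> carrier G" using \<alpha> i j by (auto intro: aut_closed gen_closed)
    have "[bil (\<alpha> (gen i)) (\<alpha> (gen j)) e = bil (\<alpha> (gen j)) (\<alpha> (gen i)) e] (mod q)" if "e \<in> pairs" for e
      using 0[OF pairs_lt(1)[OF that]] 0[OF pairs_lt(2)[OF that]]
      by (simp add: bil_def cong_iff_dvd_diff dvd_diff)
    then have "\<alpha> (gen i) \<otimes>\<^bsub>G\<^esub> \<alpha> (gen j) = \<alpha> (gen j) \<otimes>\<^bsub>G\<^esub> \<alpha> (gen i)"
      using c by (simp add: commute_iff)
    then have "gen i \<otimes>\<^bsub>G\<^esub> gen j = gen j \<otimes>\<^bsub>G\<^esub> gen i"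
      using \<alpha> i j by (simp add: aut_mult[symmetric] gen_closed aut_inj)
    then show False using gen_not_commute i j by blast
  qed
next
  fix i assume i: "1 \<le> i" "i < n"
  then have "gen i \<in> carrier G" "gen (i - 1) \<in> carrier G" by (auto intro: gen_closed)
  then show "pc_rel n q (hat (\<alpha> (gen i))) (hat (\<alpha> (gen (i - 1)))) (hat (\<alpha> (gen i)))"
    using aut_pc_rel[OF \<alpha>] pc_rel_gen[OF i] by blast
next
  have "gen (n - 1) \<in> carrier G" "gen 1 \<in> carrier G" "gen 0 \<in> carrier G"
    using n4 by (auto intro: gen_closed)
  then show "pc_rel n q (hat (\<alpha> (gen (n - 1)))) (hat (\<alpha> (gen 1))) (hat (\<alpha> (gen 0)))"
    using aut_pc_rel[OF \<alpha>] pc_rel_gen_0 by blast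
qed

text \<open>The commutator of two generators depends on their exponents modulo \<open>q\<close>
  only, and these are unchanged by \<open>aut_gen\<close>.\<close>

lemma aut_unit_W:
  assumes \<alpha>: "\<alpha> \<in> iso G G" and e: "e \<in> pairs"
  shows "\<alpha> (unit_W e) = unit_W e"
proof -
  obtain a b where ab: "e = (a, b)" "b < a" "a < n" using e by (auto simp: pairs_def)
  have comm: "x \<otimes>\<^bsub>G\<^esub> y = unit_W e \<otimes>\<^bsub>G\<^esub> (y \<otimes>\<^bsub>G\<^esub> x)"
    if x: "x \<in> carrier G" "\<And>j. j < n \<Longrightarrow> [hat x j = of_bool (a = j)] (mod q)"
      and y: "y \<in> carrier G" "\<And>j. j < n \<Longrightarrow> [hat y j = of_bool (b = j)] (mod q)" for x y
  proof (subst commutator_iff[OF x(1) y(1) unit_W_in_W], rule ballI)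
    fix e' assume e': "e' \<in> pairs"
    have "[bil x y e' - bil y x e' = of_bool (a = fst e') * of_bool (b = snd e') - of_bool (b = fst e') * of_bool (a = snd e')] (mod q)"
      unfolding bil_def using pairs_lt[OF e'] by (intro cong_diff cong_mult x y) auto
    also have "of_bool (a = fst e') * of_bool (b = snd e') - of_bool (b = fst e') * of_bool (a = snd e') = (of_bool (e' = e) :: int)"
      using ab e' by (auto simp: pairs_def)
    finally have "[q * (bil x y e' - bil y x e') = q * of_bool (e' = e)] (mod q\<^sup>2)" by (simp only: q_cong)
    with unit_W_cong[OF e', of e] show "[unit_W e e' = q * (bil x y e' - bil y x e')] (mod q\<^sup>2)"
      by (rule cong_trans[OF _ cong_sym])
  qed
  have "unit_W e \<in> carrier G" by (rule W_closed[OF unit_W_in_W])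
  moreover have g: "gen a \<in> carrier G" "gen b \<in> carrier G" using ab by (auto intro: gen_closed)
  moreover have "gen a \<otimes>\<^bsub>G\<^esub> gen b = unit_W e \<otimes>\<^bsub>G\<^esub> (gen b \<otimes>\<^bsub>G\<^esub> gen a)"
    using ab g by (intro comm) (simp_all add: hat_gen)
  then have "\<alpha> (gen a \<otimes>\<^bsub>G\<^esub> gen b) = \<alpha> (unit_W e \<otimes>\<^bsub>G\<^esub> (gen b \<otimes>\<^bsub>G\<^esub> gen a))" by simp
  ultimately have "\<alpha> (gen a) \<otimes>\<^bsub>G\<^esub> \<alpha> (gen b) = \<alpha> (unit_W e) \<otimes>\<^bsub>G\<^esub> (\<alpha> (gen b) \<otimes>\<^bsub>G\<^esub> \<alpha> (gen a))"
    using \<alpha> by (simp add: aut_mult)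
  moreover have "\<alpha> (gen a) \<otimes>\<^bsub>G\<^esub> \<alpha> (gen b) = unit_W e \<otimes>\<^bsub>G\<^esub> (\<alpha> (gen b) \<otimes>\<^bsub>G\<^esub> \<alpha> (gen a))"
    using ab g \<alpha> by (intro comm) (simp_all add: aut_gen aut_closed)
  ultimately show ?thesis
    using g \<alpha> \<open>unit_W e \<in> carrier G\<close> by (simp add: aut_closed)
qed

lemma unit_W_pow_cong:
  assumes "e' \<in> pairs"
  shows "[(unit_W e [^]\<^bsub>G\<^esub> (k::nat)) e' = int k * (q * of_bool (e' = e))] (mod q\<^sup>2)"
proof -
  have u: "unit_W e \<in> carrier G" by (rule W_closed[OF unit_W_in_W])
  have "q dvd hat (unit_W e) (fst e')"
    using hat_W[OF unit_W_in_W] pairs_lt[OF assms] by (simp add: cong_0_iff)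
  then have "[int (k choose 2) * bil (unit_W e) (unit_W e) e' = 0] (mod q)"
    by (simp add: bil_def cong_0_iff)
  then have "[int k * unit_W e e' + q * (int (k choose 2) * bil (unit_W e) (unit_W e) e') =
      int k * (q * of_bool (e' = e)) + q * 0] (mod q\<^sup>2)"
    by (intro cong_add cong_mult cong_refl unit_W_cong assms q_cong[THEN iffD2])
  from cong_trans[OF pow_cong[OF u assms] this] show ?thesis by simp
qed

text \<open>The elements \<open>unit_W e\<close> are fixed and generate \<open>W\<close>. The
  induction runs over a set containing the support: one coordinate of w is split off as a power of
  \<open>unit_W e\<close>.\<close>

lemma aut_W:
  assumes \<alpha>: "\<alpha> \<in> iso G G" and "w \<in> W"
  shows "\<alpha> w = w"
proof -
  have "\<forall>w\<in>W. (\<forall>e\<in>pairs. e \<notin> S \<longrightarrow> w e = 0) \<longrightarrow> \<alpha> w = w" if "finite S" "S \<subseteq> pairs" for S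
    using that
  proof (induction S rule: finite_induct)
    case empty
    show ?case
    proof (intro ballI impI)
      fix w assume "w \<in> W" "\<forall>e\<in>pairs. e \<notin> {} \<longrightarrow> w e = 0"
      then have "w = \<one>\<^bsub>G\<^esub>" by (subst carrier_eq_iff) (auto simp: W_closed one_coord)
      then show "\<alpha> w = w" using \<alpha> by (simp add: aut_one)
    qed
  next
    case (insert e S)
    then have e: "e \<in> pairs" by simp
    show ?case
    proof (intro ballI impI)
      fix w assume w: "w \<in> W" and supp: "\<forall>e'\<in>pairs. e' \<notin> insert e S \<longrightarrow> w e' = 0"
      define w' where "w' = red (\<lambda>e'. if e' = e then 0 else w e')"
      have "0 \<le> w e" "q dvd w e" using w e by (auto simp: W_def G_def)
      then obtain c where c: "w e = q * c" "0 \<le> c" using q_pos by (auto simp: zero_le_mult_iff)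
      define k where "k = nat c"
      have k: "w e = int k * q" using c by (simp add: k_def)
      have w'_coord: "w' e' = (if e' = e then 0 else w e')" if "e' \<in> pairs" for e'
        using that w by (auto simp: w'_def red_def W_def G_def)
      have "w' \<in> carrier G" unfolding w'_def using w by (intro red_closed) (auto simp: W_def)
      then have w': "w' \<in> W" using w w'_coord by (auto simp: W_def)
      then have "\<alpha> w' = w'" using insert supp w'_coord by auto
      have u: "unit_W e [^]\<^bsub>G\<^esub> k \<in> carrier G" using W_closed[OF unit_W_in_W] by simp
      have "[(w' \<otimes>\<^bsub>G\<^esub> unit_W e [^]\<^bsub>G\<^esub> k) e' = w e'] (mod q\<^sup>2)" if e': "e' \<in> pairs" for e'
      proof -
        have "[w' e' + (unit_W e [^]\<^bsub>G\<^esub> k) e' = w' e' + int k * (q * of_bool (e' = e))] (mod q\<^sup>2)"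
          by (intro cong_add cong_refl unit_W_pow_cong e')
        from cong_trans[OF W_mult_cong[OF w' e', of "unit_W e [^]\<^bsub>G\<^esub> k"] this] show ?thesis
          using w'_coord[OF e'] k by (cases "e' = e") simp_all
      qed
      then have "w' \<otimes>\<^bsub>G\<^esub> unit_W e [^]\<^bsub>G\<^esub> k = w"
        using w w' u by (subst carrier_eq_iff) (auto simp: W_closed)
      moreover have "\<alpha> (w' \<otimes>\<^bsub>G\<^esub> unit_W e [^]\<^bsub>G\<^esub> k) = w' \<otimes>\<^bsub>G\<^esub> unit_W e [^]\<^bsub>G\<^esub> k"
        using \<alpha> w' u e \<open>\<alpha> w' = w'\<close> W_closed[OF unit_W_in_W, of e]
        by (simp add: aut_mult aut_pow aut_unit_W W_closed)
      ultimately show "\<alpha> w = w" by simp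
    qed
  qed
  from this[OF finite_pairs subset_refl] assms(2) show ?thesis by blast
qed

text \<open>The commutator of x with \<open>gen j\<close> lies in \<open>W\<close>, hence is fixed,
  and the exponents of \<open>gen j\<close> are preserved. For j different from i, its coordinate at
  the pair formed by i and j is the i-th exponent of x up to a sign, which depends on which index is
  larger.\<close>

lemma aut_hat:
  assumes \<alpha>: "\<alpha> \<in> iso G G" and x: "x \<in> carrier G" and i: "i < n"
  shows "[hat (\<alpha> x) i = hat x i] (mod q)"
proof -
  obtain j where j: "j < n" "i \<noteq> j"
    using n4 that[of 1] that[of 0] by (cases "i = 0") auto
  define e where "e = (max i j, min i j)"
  have e: "e \<in> pairs" using i j by (auto simp: e_def pairs_def)
  have g: "gen j \<in> carrier G" by (rule gen_closed[OF j(1)])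
  obtain w where w: "w \<in> W" "x \<otimes>\<^bsub>G\<^esub> gen j = w \<otimes>\<^bsub>G\<^esub> (gen j \<otimes>\<^bsub>G\<^esub> x)"
    using ex_commutator[OF x g] by blast
  from w(2) have "\<alpha> (x \<otimes>\<^bsub>G\<^esub> gen j) = \<alpha> (w \<otimes>\<^bsub>G\<^esub> (gen j \<otimes>\<^bsub>G\<^esub> x))" by simp
  then have w\<alpha>: "\<alpha> x \<otimes>\<^bsub>G\<^esub> \<alpha> (gen j) = w \<otimes>\<^bsub>G\<^esub> (\<alpha> (gen j) \<otimes>\<^bsub>G\<^esub> \<alpha> x)"
    using \<alpha> w(1) x g by (simp add: aut_mult aut_W W_closed)
  have 1: "[w e = q * (bil x (gen j) e - bil (gen j) x e)] (mod q\<^sup>2)"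
    using commutator_iff[OF x g w(1)] w(2) e by blast
  have 2: "[w e = q * (bil (\<alpha> x) (\<alpha> (gen j)) e - bil (\<alpha> (gen j)) (\<alpha> x) e)] (mod q\<^sup>2)"
    using commutator_iff[OF aut_closed[OF \<alpha> x] aut_closed[OF \<alpha> g] w(1)] w\<alpha> e by blast
  have "[bil (\<alpha> x) (\<alpha> (gen j)) e - bil (\<alpha> (gen j)) (\<alpha> x) e = bil x (gen j) e - bil (gen j) x e] (mod q)"
    using cong_trans[OF cong_sym[OF 2] 1] by (simp only: q_cong)
  moreover have "[bil (\<alpha> x) (\<alpha> (gen j)) e - bil (\<alpha> (gen j)) (\<alpha> x) e = bil (\<alpha> x) (gen j) e - bil (gen j) (\<alpha> x) e] (mod q)"
    using aut_gen[OF \<alpha> j(1)] hat_gen[OF j(1)] by (intro cong_diff bil_cong e cong_refl) simp_all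
  ultimately have *: "[bil (\<alpha> x) (gen j) e - bil (gen j) (\<alpha> x) e = bil x (gen j) e - bil (gen j) x e] (mod q)"
    by (rule cong_trans[OF cong_sym, rotated])
  show ?thesis
  proof (cases "j < i")
    case True
    then show ?thesis using * i j by (simp add: e_def bil_def hat_gen max_def min_def)
  next
    case False
    then have "[- hat (\<alpha> x) i = - hat x i] (mod q)"
      using * i j by (simp add: e_def bil_def hat_gen max_def min_def)
    then show ?thesis by (simp add: cong_minus_minus_iff)
  qed
qed

text \<open>The maps \<open>F\<close> into \<open>W\<close> for which \<open>x \<mapsto> x F(x)\<close> is a central automorphism.\<close>

definition displacement :: "((nat \<times> nat \<Rightarrow> int) \<Rightarrow> nat \<times> nat \<Rightarrow> int) \<Rightarrow> bool" where
  "displacement F \<longleftrightarrow>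
     (\<forall>x\<in>carrier G. \<forall>e\<in>pairs. q dvd F x e) \<and>
     (\<forall>x\<in>carrier G. \<forall>y\<in>carrier G. \<forall>e\<in>pairs. [F (x \<otimes>\<^bsub>G\<^esub> y) e = F x e + F y e] (mod q\<^sup>2)) \<and>
     (\<forall>x\<in>carrier G. \<forall>y\<in>carrier G. (\<forall>i<n. [hat x i = hat y i] (mod q)) \<longrightarrow>
        (\<forall>e\<in>pairs. [F x e = F y e] (mod q\<^sup>2)))"

text \<open>Preservation of exponents makes the difference a multiple of \<open>q\<close> and leaves
  the bilinear term unchanged, so the difference is additive. It depends on exponents only because
  elements with equal exponents differ by an element of \<open>W\<close>, which is fixed.\<close>

lemma displacement_aut:
  assumes \<alpha>: "\<alpha> \<in> iso G G"
  shows "displacement (\<lambda>x e. \<alpha> x e - x e)"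
  unfolding displacement_def
proof (intro conjI ballI impI)
  fix x e assume x: "x \<in> carrier G" and e: "e \<in> pairs"
  show "q dvd \<alpha> x e - x e"
  proof (cases "e \<in> edges")
    case True
    then obtain i where "i < n" "e = edge i" by (auto simp: edges_def)
    then show ?thesis using aut_hat[OF \<alpha> x] by (simp add: hat_def cong_iff_dvd_diff)
  next
    case False
    then show ?thesis using dvd_coord x e aut_closed[OF \<alpha> x] by (simp add: dvd_diff)
  qed
next
  fix x y e assume x: "x \<in> carrier G" and y: "y \<in> carrier G" and e: "e \<in> pairs"
  have "[q * bil (\<alpha> x) (\<alpha> y) e = q * bil x y e] (mod q\<^sup>2)"
    unfolding q_cong using \<alpha> x y e by (intro bil_cong aut_hat)
  then have "[\<alpha> x e + \<alpha> y e + q * bil (\<alpha> x) (\<alpha> y) e = \<alpha> x e + \<alpha> y e + q * bil x y e] (mod q\<^sup>2)"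
    by (intro cong_add cong_refl)
  from cong_diff[OF cong_trans[OF mult_cong[OF e, of "\<alpha> x" "\<alpha> y"] this] mult_cong[OF e, of x y]]
  have "[(\<alpha> x \<otimes>\<^bsub>G\<^esub> \<alpha> y) e - (x \<otimes>\<^bsub>G\<^esub> y) e = \<alpha> x e - x e + (\<alpha> y e - y e)] (mod q\<^sup>2)"
    by (simp add: algebra_simps)
  then show "[\<alpha> (x \<otimes>\<^bsub>G\<^esub> y) e - (x \<otimes>\<^bsub>G\<^esub> y) e = \<alpha> x e - x e + (\<alpha> y e - y e)] (mod q\<^sup>2)"
    using \<alpha> x y by (simp add: aut_mult)
next
  fix x y e
  assume x: "x \<in> carrier G" and y: "y \<in> carrier G" and e: "e \<in> pairs"
    and hats: "\<forall>i<n. [hat x i = hat y i] (mod q)"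
  \<comment> \<open>The quotient of y by x: equal exponents put it into \<open>W\<close>, where
    products are sums of coordinates.\<close>
  let ?w = "red (\<lambda>e. y e - x e)"
  have dvd: "q dvd y e - x e" if "e \<in> pairs" for e
  proof (cases "e \<in> edges")
    case True
    then obtain i where i: "i < n" "e = edge i" by (auto simp: edges_def)
    have "[hat y i = hat x i] (mod q)" using hats i(1) by (simp add: cong_sym)
    then show ?thesis using i(2) by (simp add: hat_def cong_iff_dvd_diff)
  next
    case False
    then show ?thesis using dvd_coord x y that by (simp add: dvd_diff)
  qed
  have "q dvd ?w e" if "e \<in> pairs" for e
    using cong_q_square[OF red_cong[OF that, of "\<lambda>e. y e - x e"]] dvd[OF that] cong_dvd_iff by blast
  then have w: "?w \<in> W" unfolding W_def using dvd by (auto intro!: red_closed)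
  have "[(?w \<otimes>\<^bsub>G\<^esub> x) e = y e] (mod q\<^sup>2)" if "e \<in> pairs" for e
    using cong_trans[OF W_mult_cong[OF w that, of x] cong_add[OF red_cong[OF that, of "\<lambda>e. y e - x e"] cong_refl[of "x e"]]]
    by simp
  then have y_eq: "?w \<otimes>\<^bsub>G\<^esub> x = y" using x y w by (subst carrier_eq_iff) (auto simp: W_closed)
  then have "\<alpha> y = ?w \<otimes>\<^bsub>G\<^esub> \<alpha> x" using \<alpha> x w aut_mult[OF \<alpha> W_closed[OF w] x] by (simp add: aut_W)
  then have "[\<alpha> y e - y e = (?w e + \<alpha> x e) - (?w e + x e)] (mod q\<^sup>2)"
    using cong_diff[OF W_mult_cong[OF w e, of "\<alpha> x"] W_mult_cong[OF w e, of x]] y_eq by simp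
  then show "[\<alpha> x e - x e = \<alpha> y e - y e] (mod q\<^sup>2)" by (simp add: cong_sym_eq)
qed

text \<open>Adding multiples of \<open>q\<close> changes neither exponents nor \<open>bil\<close>,
  so additivity of F gives a homomorphism. Equal images have equal exponents, hence equal
  displacements, which gives injectivity; finiteness does the rest.\<close>

lemma aut_of_displacement:
  assumes F: "displacement F"
  defines "\<beta> \<equiv> \<lambda>x. red (\<lambda>e. x e + F x e)"
  shows "\<beta> \<in> iso G G" and "\<And>x i. x \<in> carrier G \<Longrightarrow> i < n \<Longrightarrow> [hat (\<beta> x) i = hat x i] (mod q)"
proof -
  have dvd: "q dvd F x e" if "x \<in> carrier G" "e \<in> pairs" for x e
    using F that by (simp add: displacement_def)
  have hom: "[F (x \<otimes>\<^bsub>G\<^esub> y) e = F x e + F y e] (mod q\<^sup>2)" if "x \<in> carrier G" "y \<in> carrier G" "e \<in> pairs" for x y e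
    using F that by (simp add: displacement_def)
  have inv: "[F x e = F y e] (mod q\<^sup>2)"
    if "x \<in> carrier G" "y \<in> carrier G" "\<And>i. i < n \<Longrightarrow> [hat x i = hat y i] (mod q)" "e \<in> pairs" for x y e
    using F that unfolding displacement_def by blast
  have \<beta>: "[\<beta> x e = x e + F x e] (mod q\<^sup>2)" if "e \<in> pairs" for x e
    using red_cong[OF that, of "\<lambda>e. x e + F x e"] by (simp add: \<beta>_def)
  show hat: "[hat (\<beta> x) i = hat x i] (mod q)" if x: "x \<in> carrier G" and i: "i < n" for x i
  proof -
    have "[x (edge i) + F x (edge i) = x (edge i)] (mod q)"
      using dvd[OF x edge_in_pairs[OF i]] by (simp add: cong_iff_dvd_diff)
    with cong_q_square[OF \<beta>[OF edge_in_pairs[OF i]]] show ?thesis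
      unfolding hat_def by (rule cong_trans)
  qed
  have closed: "\<beta> x \<in> carrier G" if "x \<in> carrier G" for x
    unfolding \<beta>_def using that by (intro red_closed dvd_add dvd_coord dvd)
  have "\<beta> (x \<otimes>\<^bsub>G\<^esub> y) = \<beta> x \<otimes>\<^bsub>G\<^esub> \<beta> y" if x: "x \<in> carrier G" and y: "y \<in> carrier G" for x y
  proof -
    have "[\<beta> (x \<otimes>\<^bsub>G\<^esub> y) e = (\<beta> x \<otimes>\<^bsub>G\<^esub> \<beta> y) e] (mod q\<^sup>2)" if e: "e \<in> pairs" for e
    proof -
      have "[(x \<otimes>\<^bsub>G\<^esub> y) e + F (x \<otimes>\<^bsub>G\<^esub> y) e = (x e + y e + q * bil x y e) + (F x e + F y e)] (mod q\<^sup>2)"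
        by (intro cong_add mult_cong hom x y e)
      from cong_trans[OF \<beta>[OF e] this]
      have 1: "[\<beta> (x \<otimes>\<^bsub>G\<^esub> y) e = (x e + y e + q * bil x y e) + (F x e + F y e)] (mod q\<^sup>2)" .
      have "[\<beta> x e + \<beta> y e + q * bil (\<beta> x) (\<beta> y) e = (x e + F x e) + (y e + F y e) + q * bil x y e] (mod q\<^sup>2)"
        by (intro cong_add \<beta> e q_cong[THEN iffD2] bil_cong hat x y)
      from cong_trans[OF mult_cong[OF e, of "\<beta> x" "\<beta> y"] this]
      have "[(\<beta> x \<otimes>\<^bsub>G\<^esub> \<beta> y) e = (x e + y e + q * bil x y e) + (F x e + F y e)] (mod q\<^sup>2)"
        by (simp add: algebra_simps)
      from cong_trans[OF 1 cong_sym[OF this]] show ?thesis .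
    qed
    then show ?thesis using x y closed by (subst carrier_eq_iff) auto
  qed
  moreover have "inj_on \<beta> (carrier G)"
  proof (rule inj_onI)
    fix x y assume x: "x \<in> carrier G" and y: "y \<in> carrier G" and eq: "\<beta> x = \<beta> y"
    have hats: "[hat x i = hat y i] (mod q)" if "i < n" for i
      using cong_trans[OF cong_sym[OF hat[OF x that]]] hat[OF y that] eq by simp
    have "[x e = y e] (mod q\<^sup>2)" if e: "e \<in> pairs" for e
    proof -
      have "[x e + F x e = y e + F y e] (mod q\<^sup>2)"
        using cong_trans[OF cong_sym[OF \<beta>[OF e, of x]]] \<beta>[OF e, of y] eq by simp
      from cong_diff[OF this inv[OF x y hats e]] show ?thesis by simp
    qed
    then show "x = y" using x y by (simp add: carrier_eq_iff)
  qed
  moreover have "\<beta> ` carrier G \<subseteq> carrier G" using closed by blast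
  ultimately have "\<beta> ` carrier G = carrier G" using endo_inj_surj[OF finite_carrier] by blast
  then show "\<beta> \<in> iso G G"
    using \<open>inj_on \<beta> (carrier G)\<close> closed \<open>\<And>x y. \<lbrakk>x \<in> carrier G; y \<in> carrier G\<rbrakk> \<Longrightarrow> \<beta> (x \<otimes>\<^bsub>G\<^esub> y) = \<beta> x \<otimes>\<^bsub>G\<^esub> \<beta> y\<close>
    by (auto simp: iso_def hom_def bij_betw_def)
qed

subsection \<open>Permuting commutators\<close>

text \<open>Fixing the edges preserves exponents and \<open>bil\<close>, so
  \<open>\<theta> h\<close> disturbs only the position at which the bilinear term is read.
  Precomposition with \<open>\<tau> h\<close> turns the left action on pairs into the right action
  that \<open>hol_action\<close> asks for.\<close>

lemma hol_action_permutation: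
  fixes \<tau> :: "'h \<Rightarrow> nat \<times> nat \<Rightarrow> nat \<times> nat"
  assumes H: "group H"
    and \<tau>_pairs: "\<And>h e. h \<in> carrier H \<Longrightarrow> e \<in> pairs \<Longrightarrow> \<tau> h e \<in> pairs"
    and \<tau>_edges: "\<And>h e. h \<in> carrier H \<Longrightarrow> e \<in> edges \<Longrightarrow> \<tau> h e = e"
    and \<tau>_non_edges: "\<And>h e. h \<in> carrier H \<Longrightarrow> e \<in> pairs \<Longrightarrow> e \<notin> edges \<Longrightarrow> \<tau> h e \<notin> edges"
    and \<tau>_mult: "\<And>h k e. h \<in> carrier H \<Longrightarrow> k \<in> carrier H \<Longrightarrow> e \<in> pairs \<Longrightarrow> \<tau> (h \<otimes>\<^bsub>H\<^esub> k) e = \<tau> h (\<tau> k e)"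
    and \<tau>_one: "\<And>e. e \<in> pairs \<Longrightarrow> \<tau> \<one>\<^bsub>H\<^esub> e = e"
    and \<tau>_faithful: "\<And>h. h \<in> carrier H \<Longrightarrow> (\<And>e. e \<in> pairs \<Longrightarrow> \<tau> h e = e) \<Longrightarrow> h = \<one>\<^bsub>H\<^esub>"
  shows "hol_action G H (\<lambda>h x. \<lambda>e\<in>pairs. x (\<tau> h e))"
proof -
  interpret H: group H by (rule H)
  define \<theta> where "\<theta> = (\<lambda>h (x :: nat \<times> nat \<Rightarrow> int). \<lambda>e\<in>pairs. x (\<tau> h e))"
  have \<theta>: "\<theta> h x e = x (\<tau> h e)" if "e \<in> pairs" for h x e
    using that by (simp add: \<theta>_def)
  have cl: "\<theta> h x \<in> carrier G" if "h \<in> carrier H" "x \<in> carrier G" for h x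
    using that \<tau>_pairs \<tau>_non_edges unfolding G_def \<theta>_def by (simp del: split_paired_All)
  have hat\<theta>: "hat (\<theta> h x) i = hat x i" if "h \<in> carrier H" "i < n" for h x i
    using that by (simp add: hat_def \<theta> edge_in_pairs \<tau>_edges edges_def)
  have bil\<theta>: "bil (\<theta> h x) y e = bil x y e" "bil y (\<theta> h x) e = bil y x e" if "h \<in> carrier H" "e \<in> pairs" for h x y e
    using that pairs_lt by (simp_all add: bil_def hat\<theta>)
  have eqI: "x = y" if "x \<in> carrier G" "y \<in> carrier G" "\<And>e. e \<in> pairs \<Longrightarrow> [x e = y e] (mod q\<^sup>2)" for x y
    using that by (simp add: carrier_eq_iff)
  have mult_\<tau>: "[\<theta> h (x \<otimes>\<^bsub>G\<^esub> y) e = x (\<tau> h e) + y (\<tau> h e) + q * bil x y (\<tau> h e)] (mod q\<^sup>2)"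
    if "h \<in> carrier H" "e \<in> pairs" for h x y e
    using that by (simp add: \<theta> mult_cong \<tau>_pairs)
  have "hol_action G H \<theta>"
    unfolding hol_action_def
  proof (intro conjI ballI impI)
    fix h k x assume "h \<in> carrier H" "k \<in> carrier H" "x \<in> carrier G"
    then show "\<theta> (h \<otimes>\<^bsub>H\<^esub> k) x = \<theta> k (\<theta> h x)"
      by (auto simp: \<theta>_def \<tau>_mult \<tau>_pairs restrict_def fun_eq_iff)
  next
    fix x assume "x \<in> carrier G"
    then show "\<theta> \<one>\<^bsub>H\<^esub> x = x" by (intro eqI cl) (simp_all add: \<theta> \<tau>_one)
  next
    fix h assume "h \<in> carrier H"
    then show "\<theta> h \<one>\<^bsub>G\<^esub> = \<one>\<^bsub>G\<^esub>" by (intro eqI cl) (simp_all add: \<theta> one_coord \<tau>_pairs)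
  next
    fix h y assume h: "h \<in> carrier H" and y: "y \<in> carrier G"
    \<comment> \<open>The discrepancy between the products before and after the permutation. With y
      held fixed it is additive in z, so it is absorbed by a central automorphism.\<close>
    define F where "F = (\<lambda>z e. q * (bil z y (\<tau> h e) - bil z y e))"
    have F: "displacement F"
      unfolding displacement_def
    proof (intro conjI ballI impI)
      fix x z e assume "e \<in> pairs"
      then have "[bil (x \<otimes>\<^bsub>G\<^esub> z) y (\<tau> h e) - bil (x \<otimes>\<^bsub>G\<^esub> z) y e =
          (bil x y (\<tau> h e) + bil z y (\<tau> h e)) - (bil x y e + bil z y e)] (mod q)"
        using h by (intro cong_diff bil_mult_left \<tau>_pairs)
      then have "[F (x \<otimes>\<^bsub>G\<^esub> z) e = q * ((bil x y (\<tau> h e) + bil z y (\<tau> h e)) - (bil x y e + bil z y e))] (mod q\<^sup>2)"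
        unfolding F_def q_cong .
      then show "[F (x \<otimes>\<^bsub>G\<^esub> z) e = F x e + F z e] (mod q\<^sup>2)"
        by (simp add: F_def algebra_simps)
    next
      fix x z e assume "e \<in> pairs" "\<forall>i<n. [hat x i = hat z i] (mod q)"
      then show "[F x e = F z e] (mod q\<^sup>2)"
        unfolding F_def q_cong using h by (intro cong_diff bil_cong \<tau>_pairs cong_refl) auto
    qed (simp add: F_def)
    define \<alpha> where "\<alpha> = (\<lambda>z. red (\<lambda>e. z e + F z e))"
    have \<alpha>: "\<alpha> \<in> iso G G" "\<And>z i. z \<in> carrier G \<Longrightarrow> i < n \<Longrightarrow> [hat (\<alpha> z) i = hat z i] (mod q)"
      using aut_of_displacement[OF F] unfolding \<alpha>_def by blast+
    have "\<theta> h (x \<otimes>\<^bsub>G\<^esub> y) = \<alpha> (\<theta> h x) \<otimes>\<^bsub>G\<^esub> \<theta> h y" if x: "x \<in> carrier G" for x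
    proof (rule eqI)
      show "\<theta> h (x \<otimes>\<^bsub>G\<^esub> y) \<in> carrier G" using h x y by (simp add: cl)
      show "\<alpha> (\<theta> h x) \<otimes>\<^bsub>G\<^esub> \<theta> h y \<in> carrier G" using h x y by (simp add: cl aut_closed[OF \<alpha>(1)])
      fix e assume e: "e \<in> pairs"
      have "[bil (\<alpha> (\<theta> h x)) (\<theta> h y) e = bil (\<theta> h x) (\<theta> h y) e] (mod q)"
        using h x e by (intro bil_cong \<alpha> cl cong_refl)
      then have b: "[bil (\<alpha> (\<theta> h x)) (\<theta> h y) e = bil x y e] (mod q)" using h e by (simp add: bil\<theta>)
      have "[\<alpha> (\<theta> h x) e = \<theta> h x e + F (\<theta> h x) e] (mod q\<^sup>2)"
        unfolding \<alpha>_def by (rule red_cong[OF e])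
      then have a: "[\<alpha> (\<theta> h x) e = x (\<tau> h e) + q * (bil x y (\<tau> h e) - bil x y e)] (mod q\<^sup>2)"
        using h e \<tau>_pairs by (simp add: F_def bil\<theta> \<theta>)
      have "[\<alpha> (\<theta> h x) e + \<theta> h y e + q * bil (\<alpha> (\<theta> h x)) (\<theta> h y) e =
          x (\<tau> h e) + q * (bil x y (\<tau> h e) - bil x y e) + \<theta> h y e + q * bil x y e] (mod q\<^sup>2)"
        by (intro cong_add a cong_refl q_cong[THEN iffD2] b)
      from cong_trans[OF mult_cong[OF e, of "\<alpha> (\<theta> h x)" "\<theta> h y"] this]
      have "[(\<alpha> (\<theta> h x) \<otimes>\<^bsub>G\<^esub> \<theta> h y) e = x (\<tau> h e) + y (\<tau> h e) + q * bil x y (\<tau> h e)] (mod q\<^sup>2)"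
        using e by (simp add: \<theta> algebra_simps)
      from cong_trans[OF mult_\<tau>[OF h e] cong_sym[OF this]]
      show "[\<theta> h (x \<otimes>\<^bsub>G\<^esub> y) e = (\<alpha> (\<theta> h x) \<otimes>\<^bsub>G\<^esub> \<theta> h y) e] (mod q\<^sup>2)" .
    qed
    then show "\<exists>\<alpha>\<in>iso G G. \<forall>x\<in>carrier G. \<theta> h (x \<otimes>\<^bsub>G\<^esub> y) = \<alpha> (\<theta> h x) \<otimes>\<^bsub>G\<^esub> \<theta> h y"
      using \<alpha>(1) by blast
  next
    fix h \<alpha> assume h: "h \<in> carrier H" and \<alpha>: "\<alpha> \<in> iso G G"
    \<comment> \<open>The conjugated automorphism displaces by the same amounts at permuted
      coordinates; they may be evaluated at x instead of \<open>\<theta> h x\<close>, which has the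
      same exponents.\<close>
    define F where "F = (\<lambda>x e. \<alpha> x (\<tau> h e) - x (\<tau> h e))"
    have F: "displacement F"
      using displacement_aut[OF \<alpha>] \<tau>_pairs[OF h] unfolding displacement_def F_def by blast
    define \<beta> where "\<beta> = (\<lambda>x. red (\<lambda>e. x e + F x e))"
    have \<beta>: "\<beta> \<in> iso G G"
      using aut_of_displacement(1)[OF F] unfolding \<beta>_def .
    have "\<theta> h (\<alpha> x) = \<beta> (\<theta> h x)" if x: "x \<in> carrier G" for x
    proof (rule eqI)
      show "\<theta> h (\<alpha> x) \<in> carrier G" using h x by (intro cl aut_closed[OF \<alpha>])
      show "\<beta> (\<theta> h x) \<in> carrier G" using h x by (intro cl aut_closed[OF \<beta>])
      fix e assume e: "e \<in> pairs"
      have "\<forall>i<n. [hat (\<theta> h x) i = hat x i] (mod q)" using h by (simp add: hat\<theta>)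
      then have "[F (\<theta> h x) e = F x e] (mod q\<^sup>2)"
        using F cl[OF h x] x e unfolding displacement_def by blast
      then have "[\<theta> h x e + F (\<theta> h x) e = \<theta> h x e + F x e] (mod q\<^sup>2)"
        by (intro cong_add cong_refl)
      with red_cong[OF e, of "\<lambda>e. \<theta> h x e + F (\<theta> h x) e"]
      have "[\<beta> (\<theta> h x) e = \<theta> h x e + F x e] (mod q\<^sup>2)"
        unfolding \<beta>_def by (rule cong_trans)
      then show "[\<theta> h (\<alpha> x) e = \<beta> (\<theta> h x) e] (mod q\<^sup>2)"
        using e by (simp add: \<theta> F_def cong_sym_eq)
    qed
    then show "\<exists>\<beta>\<in>iso G G. \<forall>x\<in>carrier G. \<theta> h (\<alpha> x) = \<beta> (\<theta> h x)"
      using \<beta> by blast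
  next
    fix h assume h: "h \<in> carrier H" and hom: "\<theta> h \<in> hom G G"
    show "h = \<one>\<^bsub>H\<^esub>"
    proof (rule \<tau>_faithful[OF h])
      fix e assume e: "e \<in> pairs"
      \<comment> \<open>The product of \<open>gen a\<close> and \<open>gen b\<close> has bilinear
        term 1 at e and 0 at every other pair, so multiplicativity of \<open>\<theta> h\<close>
        forces \<open>\<tau> h e\<close> to be e.\<close>
      obtain a b where ab: "e = (a, b)" "a < n" "b < n" using e by (auto simp: pairs_def)
      have "\<theta> h (gen a \<otimes>\<^bsub>G\<^esub> gen b) = \<theta> h (gen a) \<otimes>\<^bsub>G\<^esub> \<theta> h (gen b)"
        using hom ab gen_closed by (simp add: hom_def)
      moreover have "[(\<theta> h (gen a) \<otimes>\<^bsub>G\<^esub> \<theta> h (gen b)) e =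
          gen a (\<tau> h e) + gen b (\<tau> h e) + q * bil (gen a) (gen b) e] (mod q\<^sup>2)"
        using mult_cong[OF e, of "\<theta> h (gen a)" "\<theta> h (gen b)"] h e by (simp add: \<theta> bil\<theta>)
      ultimately have "[gen a (\<tau> h e) + gen b (\<tau> h e) + q * bil (gen a) (gen b) (\<tau> h e) =
          gen a (\<tau> h e) + gen b (\<tau> h e) + q * bil (gen a) (gen b) e] (mod q\<^sup>2)"
        using cong_trans[OF cong_sym[OF mult_\<tau>[OF h e, of "gen a" "gen b"]]] by simp
      then have "[q * bil (gen a) (gen b) (\<tau> h e) = q * bil (gen a) (gen b) e] (mod q\<^sup>2)"
        by (simp add: cong_add_lcancel)
      then have "[bil (gen a) (gen b) (\<tau> h e) = bil (gen a) (gen b) e] (mod q)"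
        by (simp only: q_cong)
      moreover have "bil (gen a) (gen b) e = 1" using ab by (simp add: bil_def hat_gen)
      moreover have "bil (gen a) (gen b) (\<tau> h e) = of_bool (a = fst (\<tau> h e) \<and> b = snd (\<tau> h e))"
        using ab pairs_lt[OF \<tau>_pairs[OF h e]] by (simp add: bil_def hat_gen)
      ultimately have "[of_bool (a = fst (\<tau> h e) \<and> b = snd (\<tau> h e)) = 1] (mod q)" by simp
      then have "a = fst (\<tau> h e) \<and> b = snd (\<tau> h e)"
        using q_not_dvd_1 by (cases "a = fst (\<tau> h e) \<and> b = snd (\<tau> h e)") (auto simp: cong_iff_dvd_diff)
      then show "\<tau> h e = e" unfolding ab(1) by (metis prod.collapse)
    qed
  qed (use cl in blast)
  then show ?thesis unfolding \<theta>_def .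
qed

text \<open>H acts by left multiplication on a copy of itself inside the pairs (a, 0). Starting at a
  = 2 avoids the edge (1, 0), the only edge with second entry 0; hence the summand 2 in the
  bound.\<close>

lemma ex_hol_action:
  fixes H :: "'h monoid"
  assumes H: "group H" and fin: "finite (carrier H)" and n: "card (carrier H) + 2 \<le> n"
  shows "\<exists>\<theta>. hol_action G H \<theta>"
proof -
  interpret H: group H by (rule H)
  obtain \<nu> where \<nu>: "bij_betw \<nu> (carrier H) {0..<card (carrier H)}"
    using ex_bij_betw_finite_nat[OF fin] by blast
  define \<mu> where "\<mu> = inv_into (carrier H) \<nu>"
  have \<nu>_lt: "\<nu> h < card (carrier H)" if "h \<in> carrier H" for h
    using bij_betwE[OF \<nu>] that by auto
  have \<mu>_closed: "\<mu> a \<in> carrier H" if "a < card (carrier H)" for a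
    using bij_betwE[OF bij_betw_inv_into[OF \<nu>]] that by (auto simp: \<mu>_def)
  have \<mu>\<nu>: "\<mu> (\<nu> h) = h" if "h \<in> carrier H" for h
    using bij_betw_inv_into_left[OF \<nu> that] by (simp add: \<mu>_def)
  have \<nu>\<mu>: "\<nu> (\<mu> a) = a" if "a < card (carrier H)" for a
    using bij_betw_inv_into_right[OF \<nu>] that by (simp add: \<mu>_def)
  define A where "A = {(a, b). b = (0::nat) \<and> 2 \<le> a \<and> a < card (carrier H) + 2}"
  define \<tau> where "\<tau> = (\<lambda>h e. if e \<in> A then (\<nu> (h \<otimes>\<^bsub>H\<^esub> \<mu> (fst e - 2)) + 2, 0) else e)"
  have lt: "fst e - 2 < card (carrier H)" if "e \<in> A" for e using that by (auto simp: A_def)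
  have A_pairs: "A \<subseteq> pairs" using n by (auto simp: A_def pairs_def)
  have A_edges: "e \<notin> edges" if "e \<in> A" for e
  proof
    assume "e \<in> edges"
    then obtain i where "e = edge i" by (auto simp: edges_def)
    then show False using that by (cases "i = 0") (simp_all add: A_def edge_def)
  qed
  have \<tau>A: "\<tau> h e \<in> A" if h: "h \<in> carrier H" and e: "e \<in> A" for h e
    using \<nu>_lt[OF H.m_closed[OF h \<mu>_closed[OF lt[OF e]]]] e by (simp add: \<tau>_def) (simp add: A_def)
  have \<tau>_id: "\<tau> h e = e" if "e \<notin> A" for h e using that by (simp add: \<tau>_def)
  have "hol_action G H (\<lambda>h x. \<lambda>e\<in>pairs. x (\<tau> h e))"
  proof (rule hol_action_permutation[OF H])
    fix h e assume h: "h \<in> carrier H" and e: "e \<in> pairs"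
    show "\<tau> h e \<in> pairs" using \<tau>A[OF h, of e] \<tau>_id[of e h] A_pairs e by (cases "e \<in> A") auto
    show "\<tau> h e \<notin> edges" if "e \<notin> edges" using A_edges[OF \<tau>A[OF h, of e]] \<tau>_id[of e h] that by (cases "e \<in> A") auto
    fix k assume k: "k \<in> carrier H"
    show "\<tau> (h \<otimes>\<^bsub>H\<^esub> k) e = \<tau> h (\<tau> k e)"
    proof (cases "e \<in> A")
      case True
      then have "\<tau> h (\<tau> k e) = (\<nu> (h \<otimes>\<^bsub>H\<^esub> \<mu> (fst (\<tau> k e) - 2)) + 2, 0)"
        using \<tau>A[OF k] by (simp add: \<tau>_def)
      then show ?thesis
        using True h k \<mu>_closed[OF lt[OF True]] by (simp add: \<tau>_def \<mu>\<nu> H.m_assoc)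
    qed (simp add: \<tau>_id)
  next
    fix h e assume "h \<in> carrier H" "e \<in> edges"
    then show "\<tau> h e = e" using A_edges[of e] by (intro \<tau>_id) blast
  next
    fix e :: "nat \<times> nat"
    show "\<tau> \<one>\<^bsub>H\<^esub> e = e"
    proof (cases "e \<in> A")
      case True
      then have "(fst e - 2 + 2, 0) = e" by (auto simp: A_def)
      then show ?thesis
        using True \<mu>_closed[OF lt[OF True]] \<nu>\<mu>[OF lt[OF True]] by (simp add: \<tau>_def)
    qed (rule \<tau>_id)
  next
    fix h assume h: "h \<in> carrier H" and fix_all: "\<And>e. e \<in> pairs \<Longrightarrow> \<tau> h e = e"
    \<comment> \<open>The pair labelled by the identity of H is moved to the one labelled by
      \<open>h\<close>, which shows faithfulness.\<close>
    have e: "(\<nu> \<one>\<^bsub>H\<^esub> + 2, 0) \<in> A" using \<nu>_lt[OF H.one_closed] by (simp add: A_def)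
    have "\<tau> h (\<nu> \<one>\<^bsub>H\<^esub> + 2, 0) = (\<nu> h + 2, 0)"
      using e h by (simp add: \<tau>_def \<mu>\<nu>)
    then have "\<nu> h = \<nu> \<one>\<^bsub>H\<^esub>" using fix_all[OF subsetD[OF A_pairs e]] by simp
    then have "\<mu> (\<nu> h) = \<mu> (\<nu> \<one>\<^bsub>H\<^esub>)" by (rule arg_cong)
    then show "h = \<one>\<^bsub>H\<^esub>" by (simp only: \<mu>\<nu> h H.one_closed)
  qed
  then show ?thesis by blast
qed

lemma has_nilpotency_class_G: "has_nilpotency_class G 2"
proof (rule has_nilpotency_class_2I[of W "gen 0" "gen 1"])
  show "W \<subseteq> carrier G" by (auto simp: W_closed)
  show "gen 0 \<in> carrier G" "gen 1 \<in> carrier G" using n4 by (auto intro: gen_closed)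
  show "gen 0 \<otimes>\<^bsub>G\<^esub> gen 1 \<noteq> gen 1 \<otimes>\<^bsub>G\<^esub> gen 0" using n4 by (intro gen_not_commute) auto
  fix x y assume x: "x \<in> carrier G"
  show "y \<otimes>\<^bsub>G\<^esub> x = x \<otimes>\<^bsub>G\<^esub> y" if "y \<in> W" by (rule W_central[OF that x])
  show "\<exists>z\<in>W. x \<otimes>\<^bsub>G\<^esub> y = z \<otimes>\<^bsub>G\<^esub> (y \<otimes>\<^bsub>G\<^esub> x)" if "y \<in> carrier G" by (rule ex_commutator[OF x that])
qed

end

section \<open>Choice of the bound and transfer to natural numbers\<close>

theorem corollary1p2:
  fixes p :: nat and H :: "'h monoid"
  assumes "Factorial_Ring.prime p" and "odd p"
    and "group H" and "finite (carrier H)"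
  shows "\<exists>N::nat. \<forall>n\<ge>N. \<exists>G :: nat monoid.
           group G \<and> finite (carrier G) \<and>
           order G = p ^ (n + (n choose 2)) \<and>
           has_nilpotency_class G 2 \<and>
           (\<exists>K. subgroup K (T_group G) \<and> H \<cong> (T_group G)\<lparr>carrier := K\<rparr>)"
proof (rule exI, intro allI impI)
  \<comment> \<open>This assumption instantiates the bound \<open>N\<close>. It covers both the 4
    generators needed for rigidity and the room for the regular action of H.\<close>
  fix n assume n: "card (carrier H) + 4 \<le> n"
  interpret R: rigid_p_group p n
    using assms n by unfold_locales auto
  obtain \<theta> where \<theta>: "hol_action R.G H \<theta>"
    using R.ex_hol_action[OF assms(3,4)] n by auto
  obtain f :: "_ \<Rightarrow> nat" where f: "inj_on f (carrier R.G)"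
    using finite_imp_inj_to_nat_seg[OF R.finite_carrier] by blast
  \<comment> \<open>The elements of \<open>R.G\<close> are functions; an injection of the finite
    carrier into the natural numbers provides the copy of the required type.\<close>
  let ?G = "image_group f R.G"
  have iso: "f \<in> iso R.G ?G"
    using f by (auto simp: iso_def hom_def bij_betw_def image_group_def)
  have G: "group ?G"
    using R.iso_imp_img_group[OF iso] by (simp add: image_group_def)
  have "finite (carrier ?G)" "order ?G = order R.G"
    using f R.finite_carrier by (simp_all add: image_group_def order_def card_image)
  moreover have "has_nilpotency_class ?G 2"
    using has_nilpotency_class_iso[OF R.is_group G iso] R.has_nilpotency_class_G by simp
  moreover have "\<exists>K. subgroup K (T_group ?G) \<and> H \<cong> (T_group ?G)\<lparr>carrier := K\<rparr>"
    by (rule hol_action_embeds_T_group[OF G assms(3) hol_action_iso[OF R.is_group G assms(3) iso \<theta>]])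
  ultimately show "\<exists>G :: nat monoid. group G \<and> finite (carrier G) \<and> order G = p ^ (n + (n choose 2)) \<and>
      has_nilpotency_class G 2 \<and> (\<exists>K. subgroup K (T_group G) \<and> H \<cong> (T_group G)\<lparr>carrier := K\<rparr>)"
    using G by (auto simp: R.order_G)
qed

end
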